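(* Let $K$ be a field, let $1 \le m \le n$ be integers, let $X = (X_{ij})$ be an $m \times n$ matrix of distinct indeterminates over $K$, and let $K[X] = K[X_{ij} : 1 \le i \le m,\ 1 \le j \le n]$. Let $s \ge 1$ and let $1 \le k_1 \le k_2 \le \cdots \le k_s < n$ and $1 < l_1 \le l_2 \le \cdots \le l_s \le n$ be integers such that $k_i < l_i$ and $l_i - k_i + 1 \ge m$ for every $1 \le i \le s$. Then the ideal $J := J_{k_1 l_1} J_{k_2 l_2} \cdots J_{k_s l_s}$ of $K[X]$ has a linear free resolution.
   Context: For integers $1 \le k < l \le n$ with $l - k + 1 \ge m$, let $Y_{kl}$ be the submatrix of $X$ formed by the consecutive columns from the $k$th to the $l$th. A diagonal monomial of $Y_{kl}$ is a monomial $X_{1 c_1} X_{2 c_2} \cdots X_{m c_m}$ with $k \le c_1 < c_2 < \cdots < c_m \le l$ (the product of the main diagonal entries of an $m \times m$ submatrix of $Y_{kl}$). $J_{kl}$ denotes the ideal of $K[X]$ generated by all diagonal monomials of $Y_{kl}$. $K[X]$ carries the standard grading. A homogeneous ideal $I \subseteq K[X]$ generated by homogeneous elements all of the same degree $d$ has a linear free resolution if its minimal graded free resolution has the form $\cdots \to K[X](-d-1)^{\beta_1} \to K[X](-d)^{\beta_0} \to I \to 0$, i.e. the $i$th free module is a direct sum of copies of $K[X](-d-i)$ for all $i \ge 0$; equivalently, the Castelnuovo-Mumford regularity satisfies $\operatorname{reg}(I) = d$. (For $J$ above, $d = sm$.) *)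

theory Defs
  imports "HOL-Library.Poly_Mapping" "HOL-Algebra.Module" "HOL-Algebra.Ideal_Product"
begin

text \<open>
  Polynomials are finitely supported maps from exponent vectors to coefficients. The type
  contains polynomials in all variables of type \<open>'v\<close>; the ring \<open>K[V]\<close> consists of those in which
  only variables from \<open>V\<close> occur.
\<close>

type_synonym ('v, 'k) mpoly = "('v \<Rightarrow>\<^sub>0 nat) \<Rightarrow>\<^sub>0 'k"

definition poly_ring :: "'v set \<Rightarrow> ('v, 'k::field) mpoly ring" where
  "poly_ring V = \<lparr>carrier = {p. \<forall>t\<in>Poly_Mapping.keys p. Poly_Mapping.keys t \<subseteq> V},
     monoid.mult = (*), one = 1, zero = 0, add = (+)\<rparr>"

definition var :: "'v \<Rightarrow> ('v, 'k::field) mpoly" where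
  "var x = Poly_Mapping.single (Poly_Mapping.single x 1) 1"

definition monom_degree :: "('v \<Rightarrow>\<^sub>0 nat) \<Rightarrow> nat" where
  "monom_degree t = (\<Sum>x\<in>Poly_Mapping.keys t. Poly_Mapping.lookup t x)"

text \<open>The degree \<open>e\<close> component of the standard grading; it is zero for negative \<open>e\<close>.\<close>

definition poly_component :: "'v set \<Rightarrow> int \<Rightarrow> ('v, 'k::field) mpoly set" where
  "poly_component V e =
     {p \<in> carrier (poly_ring V). \<forall>t\<in>Poly_Mapping.keys p. int (monom_degree t) = e}"

definition irrelevant_ideal :: "'v set \<Rightarrow> ('v, 'k::field) mpoly set" where
  "irrelevant_ideal V = Idl\<^bsub>poly_ring V\<^esub> (var ` V)"


text \<open>
  The ring as a module over itself, and the free module of rank \<open>b\<close>, realised as the sequences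
  vanishing from position \<open>b\<close> on. The fields \<open>mult\<close> and \<open>one\<close> of the module record play no role.
\<close>

definition self_module :: "'a ring \<Rightarrow> ('a, 'a) module" where
  "self_module R = \<lparr>carrier = carrier R, monoid.mult = undefined, one = undefined,
     zero = \<zero>\<^bsub>R\<^esub>, add = add R, smult = monoid.mult R\<rparr>"

definition free_module :: "'a ring \<Rightarrow> nat \<Rightarrow> ('a, nat \<Rightarrow> 'a) module" where
  "free_module R b =
     \<lparr>carrier = {v. (\<forall>j<b. v j \<in> carrier R) \<and> (\<forall>j\<ge>b. v j = \<zero>\<^bsub>R\<^esub>)},
      monoid.mult = undefined, one = undefined,
      zero = (\<lambda>j. \<zero>\<^bsub>R\<^esub>), add = (\<lambda>u v j. u j \<oplus>\<^bsub>R\<^esub> v j),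
      smult = (\<lambda>r v j. r \<otimes>\<^bsub>R\<^esub> v j)\<rparr>"

definition linear_map :: "'a ring \<Rightarrow> ('a, 'b) module \<Rightarrow> ('a, 'c) module \<Rightarrow> ('b \<Rightarrow> 'c) \<Rightarrow> bool" where
  "linear_map R M N f \<longleftrightarrow>
     f \<in> carrier M \<rightarrow> carrier N \<and>
     (\<forall>u\<in>carrier M. \<forall>v\<in>carrier M. f (u \<oplus>\<^bsub>M\<^esub> v) = f u \<oplus>\<^bsub>N\<^esub> f v) \<and>
     (\<forall>r\<in>carrier R. \<forall>v\<in>carrier M. f (r \<odot>\<^bsub>M\<^esub> v) = r \<odot>\<^bsub>N\<^esub> f v)"


text \<open>
  A list \<open>a\<close> of integers encodes the graded free module \<open>\<Oplus>\<^sub>j S(-a\<^sub>j)\<close> over \<open>S = K[V]\<close>, whose \<open>j\<close>-th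
  basis element has degree \<open>a\<^sub>j\<close>.
\<close>

abbreviation shifted_free_module ::
  "'v set \<Rightarrow> int list \<Rightarrow> (('v, 'k::field) mpoly, nat \<Rightarrow> ('v, 'k) mpoly) module" where
  "shifted_free_module V a \<equiv> free_module (poly_ring V) (length a)"

definition shifted_component :: "'v set \<Rightarrow> int list \<Rightarrow> int \<Rightarrow> (nat \<Rightarrow> ('v, 'k::field) mpoly) set" where
  "shifted_component V a e =
     {v \<in> carrier (shifted_free_module V a). \<forall>j<length a. v j \<in> poly_component V (e - a ! j)}"

text \<open>
  A graded free resolution \<open>\<cdots> \<rightarrow> F\<^sub>2 \<rightarrow> F\<^sub>1 \<rightarrow> F\<^sub>0 \<rightarrow> I \<rightarrow> 0\<close> with \<open>F\<^sub>i\<close> encoded by \<open>a i\<close>, augmentation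
  \<open>\<epsilon> : F\<^sub>0 \<rightarrow> S\<close> with image \<open>I\<close>, and \<open>\<delta> i : F\<^sub>i \<rightarrow> F\<^sub>i\<^sub>-\<^sub>1\<close> for \<open>i \<ge> 1\<close> (the map \<open>\<delta> 0\<close> is irrelevant);
  all maps are homogeneous of degree 0. Finite resolutions are those with \<open>a i = []\<close> eventually.
\<close>

definition graded_free_resolution ::
  "'v set \<Rightarrow> ('v, 'k::field) mpoly set \<Rightarrow> (nat \<Rightarrow> int list) \<Rightarrow>
   ((nat \<Rightarrow> ('v, 'k) mpoly) \<Rightarrow> ('v, 'k) mpoly) \<Rightarrow>
   (nat \<Rightarrow> (nat \<Rightarrow> ('v, 'k) mpoly) \<Rightarrow> (nat \<Rightarrow> ('v, 'k) mpoly)) \<Rightarrow> bool" where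
  "graded_free_resolution V I a \<epsilon> \<delta> \<longleftrightarrow>
     (let S = poly_ring V; F = (\<lambda>i. shifted_free_module V (a i)) in
      linear_map S (F 0) (self_module S) \<epsilon> \<and>
      (\<forall>e. \<epsilon> ` shifted_component V (a 0) e \<subseteq> poly_component V e) \<and>
      (\<forall>i. linear_map S (F (Suc i)) (F i) (\<delta> (Suc i)) \<and>
           (\<forall>e. \<delta> (Suc i) ` shifted_component V (a (Suc i)) e \<subseteq> shifted_component V (a i) e)) \<and>
      \<epsilon> ` carrier (F 0) = I \<and>
      \<delta> 1 ` carrier (F 1) = a_kernel (F 0) (self_module S) \<epsilon> \<and>
      (\<forall>i. \<delta> (Suc (Suc i)) ` carrier (F (Suc (Suc i)))
             = a_kernel (F (Suc i)) (F i) (\<delta> (Suc i))))"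

text \<open>Minimality: the image of \<open>F\<^sub>i\<^sub>+\<^sub>1\<close> lies in \<open>\<mm> F\<^sub>i\<close>, where \<open>\<mm>\<close> is the irrelevant ideal.\<close>

definition minimal_graded_free_resolution ::
  "'v set \<Rightarrow> ('v, 'k::field) mpoly set \<Rightarrow> (nat \<Rightarrow> int list) \<Rightarrow>
   ((nat \<Rightarrow> ('v, 'k) mpoly) \<Rightarrow> ('v, 'k) mpoly) \<Rightarrow>
   (nat \<Rightarrow> (nat \<Rightarrow> ('v, 'k) mpoly) \<Rightarrow> (nat \<Rightarrow> ('v, 'k) mpoly)) \<Rightarrow> bool" where
  "minimal_graded_free_resolution V I a \<epsilon> \<delta> \<longleftrightarrow>
     graded_free_resolution V I a \<epsilon> \<delta> \<and>
     (\<forall>i. \<forall>v\<in>carrier (shifted_free_module V (a (Suc i))).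
        \<forall>j<length (a i). \<delta> (Suc i) v j \<in> irrelevant_ideal V)"

text \<open>
  The \<open>i\<close>-th module is a direct sum of copies of \<open>S(-d-i)\<close>. The case \<open>i = 0\<close> forces \<open>I\<close> to be an
  ideal generated by homogeneous elements of degree \<open>d\<close>. Minimal graded free resolutions are unique
  up to isomorphism, so existence of one of this form is the property of ``the'' resolution.
\<close>

definition has_linear_free_resolution :: "'v set \<Rightarrow> nat \<Rightarrow> ('v, 'k::field) mpoly set \<Rightarrow> bool" where
  "has_linear_free_resolution V d I \<longleftrightarrow>
     (\<exists>a \<epsilon> \<delta>. minimal_graded_free_resolution V I a \<epsilon> \<delta> \<and>
        (\<forall>i. \<forall>j<length (a i). a i ! j = int d + int i))"


text \<open>
  The variable \<open>(i, j)\<close> is the matrix entry \<open>X\<^sub>i\<^sub>j\<close>. A diagonal monomial of \<open>Y\<^sub>k\<^sub>l\<close> is determined by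
  the columns \<open>k \<le> c 1 < \<dots> < c m \<le> l\<close>.
\<close>

abbreviation matrix_ring :: "nat \<Rightarrow> nat \<Rightarrow> (nat \<times> nat, 'k::field) mpoly ring" where
  "matrix_ring m n \<equiv> poly_ring ({1..m} \<times> {1..n})"

definition diagonal_monomials :: "nat \<Rightarrow> nat \<Rightarrow> nat \<Rightarrow> (nat \<times> nat, 'k::field) mpoly set" where
  "diagonal_monomials m k l =
     {\<Prod>i\<in>{1..m}. var (i, c i) | c. c \<in> {1..m} \<rightarrow> {k..l} \<and> strict_mono_on {1..m} c}"

definition diagonal_ideal :: "nat \<Rightarrow> nat \<Rightarrow> nat \<Rightarrow> nat \<Rightarrow> (nat \<times> nat, 'k::field) mpoly set" where
  "diagonal_ideal m n k l = Idl\<^bsub>matrix_ring m n\<^esub> (diagonal_monomials m k l)"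


lemma poly_ring_simps:
  "carrier (poly_ring V) = {p. \<forall>t\<in>Poly_Mapping.keys p. Poly_Mapping.keys t \<subseteq> V}"
  "p \<otimes>\<^bsub>poly_ring V\<^esub> q = p * q" "\<one>\<^bsub>poly_ring V\<^esub> = 1"
  "p \<oplus>\<^bsub>poly_ring V\<^esub> q = p + q" "\<zero>\<^bsub>poly_ring V\<^esub> = 0"
  by (simp_all add: poly_ring_def)

lemma poly_ring_closed:
  shows "p \<in> carrier (poly_ring V) \<Longrightarrow> - p \<in> carrier (poly_ring V)"
    and "p \<in> carrier (poly_ring V) \<Longrightarrow> q \<in> carrier (poly_ring V) \<Longrightarrow> p + q \<in> carrier (poly_ring V)"
    and "p \<in> carrier (poly_ring V) \<Longrightarrow> q \<in> carrier (poly_ring V) \<Longrightarrow> p * q \<in> carrier (poly_ring V)"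
    and "0 \<in> carrier (poly_ring V)" and "1 \<in> carrier (poly_ring V)"
proof -
  show "- p \<in> carrier (poly_ring V)" if "p \<in> carrier (poly_ring V)"
    using that by (simp add: poly_ring_simps in_keys_iff)
next
  assume p: "p \<in> carrier (poly_ring V)" and q: "q \<in> carrier (poly_ring V)"
  show "p + q \<in> carrier (poly_ring V)"
    using p q Poly_Mapping.keys_add[of p q] unfolding poly_ring_simps by blast
  show "p * q \<in> carrier (poly_ring V)"
    unfolding poly_ring_simps
  proof safe
    fix t x assume t: "t \<in> Poly_Mapping.keys (p * q)" and x: "x \<in> Poly_Mapping.keys t"
    obtain u v where *: "t = u + v" "u \<in> Poly_Mapping.keys p" "v \<in> Poly_Mapping.keys q"
      using t keys_mult[of p q] by blast
    have "Poly_Mapping.keys u \<subseteq> V" "Poly_Mapping.keys v \<subseteq> V"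
      using p q * unfolding poly_ring_simps by blast+
    then show "x \<in> V"
      using x * Poly_Mapping.keys_add[of u v] by blast
  qed
qed (simp_all add: poly_ring_simps)

lemma poly_ring_cring: "cring (poly_ring V :: ('v, 'k::field) mpoly ring)"
proof (rule cringI)
  show "abelian_group (poly_ring V :: ('v, 'k) mpoly ring)"
  proof (rule abelian_groupI)
    fix x :: "('v, 'k) mpoly" assume x: "x \<in> carrier (poly_ring V)"
    show "\<exists>y\<in>carrier (poly_ring V). y \<oplus>\<^bsub>poly_ring V\<^esub> x = \<zero>\<^bsub>poly_ring V\<^esub>"
      using poly_ring_closed(1)[OF x] by (intro bexI[of _ "- x"]) (simp_all add: poly_ring_simps(2-))
  qed (simp_all add: poly_ring_simps(2-) poly_ring_closed ac_simps)
  show "Group.comm_monoid (poly_ring V :: ('v, 'k) mpoly ring)"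
    by (rule comm_monoidI) (simp_all add: poly_ring_simps(2-) poly_ring_closed ac_simps)
qed (simp add: poly_ring_simps(2-) distrib_right)

lemma var_in_poly_ring: "x \<in> V \<Longrightarrow> var x \<in> carrier (poly_ring V)"
  by (auto simp: var_def poly_ring_def)

text \<open>
  In particular the products of these ideals formed in \<open>ideals_set\<close> are genuine ideal products.
\<close>

lemma diagonal_ideal_ideal:
  assumes "1 \<le> k" "l \<le> n"
  shows "ideal (diagonal_ideal m n k l) (matrix_ring m n)"
proof -
  interpret cring "matrix_ring m n :: (nat \<times> nat, 'a) mpoly ring" by (rule poly_ring_cring)
  have prod: "(\<Prod>i\<in>A. f i) \<in> carrier (matrix_ring m n)"
    if "finite A" "\<forall>i\<in>A. f i \<in> carrier (matrix_ring m n)"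
    for A :: "nat set" and f :: "nat \<Rightarrow> (nat \<times> nat, 'a) mpoly"
    using that
  proof (induction A)
    case empty
    then show ?case by (simp add: poly_ring_closed)
  next
    case (insert i A)
    then show ?case by (simp add: poly_ring_closed)
  qed
  have "(diagonal_monomials m k l :: (nat \<times> nat, 'a) mpoly set) \<subseteq> carrier (matrix_ring m n)"
  proof
    fix p :: "(nat \<times> nat, 'a) mpoly" assume "p \<in> diagonal_monomials m k l"
    then obtain c where c: "p = (\<Prod>i\<in>{1..m}. var (i, c i))" "c \<in> {1..m} \<rightarrow> {k..l}"
      unfolding diagonal_monomials_def by blast
    have "(i, c i) \<in> {1..m} \<times> {1..n}" if "i \<in> {1..m}" for i
      using c(2)[THEN funcset_mem, OF that] that assms by simp
    then show "p \<in> carrier (matrix_ring m n)"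
      unfolding c(1) by (intro prod ballI var_in_poly_ring) auto
  qed
  then show ?thesis unfolding diagonal_ideal_def by (rule genideal_ideal)
qed

end

(*
  Sorting the rows of a product of diagonal monomials shows that J is generated by the monomials of
  the m x s tableaux T with weakly increasing rows, strictly increasing columns and j-th column in
  [k_j, l_j]. If A < B lexicographically and (i, j) is the first place where they differ, then replacing
  the entry B_ij by A_ij gives an earlier tableau. Hence the generators, in lexicographic order, have
  linear quotients: the colon ideal of the earlier ones by each generator is generated by variables.

  More generally, let g_1, ..., g_L be vectors of the same degree in a graded free module such that
  each (<g_1, ..., g_(j-1)> : g_j) is generated by variables. For each such variable x choose
  a syzygy x e_j - sum_(i<j) c_i e_i with linear forms c_i. These syzygies, ordered by j and then
  by x, generate the syzygy module, and again their successive colon ideals are generated by variables: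
  a relation restricted to the e_j-coordinate reads f x in (x_1, ..., x_(t-1)). Iterating yields a linear resolution.
*)
theory Submission
  imports Defs "HOL-Library.List_Lexorder" "HOL-Library.Multiset"
begin

subsection \<open>Polynomials and monomials\<close>

abbreviation supp :: "('a \<Rightarrow>\<^sub>0 'b::zero) \<Rightarrow> 'a set" where
  "supp \<equiv> Poly_Mapping.keys"

abbreviation monomial :: "('v \<Rightarrow>\<^sub>0 nat) \<Rightarrow> ('v, 'k::field) mpoly" where
  "monomial t \<equiv> Poly_Mapping.single t 1"

lemma sum_monomials: "p = (\<Sum>t\<in>supp p. Poly_Mapping.single t (Poly_Mapping.lookup p t))"
  by (rule poly_mapping_eqI)
    (simp add: lookup_sum lookup_single when_def in_keys_iff)

lemma supp_add_nat: "supp (s + t) = supp s \<union> supp t" for s t :: "'v \<Rightarrow>\<^sub>0 nat"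
  by (auto simp: in_keys_iff lookup_add)

lemma supp_sum_subset: "supp (sum f A) \<subseteq> (\<Union>i\<in>A. supp (f i))"
proof (induction A rule: infinite_finite_induct)
  case (insert x F)
  then show ?case using keys_add[of "f x" "sum f F"] by auto
qed auto

lemma monom_degree_superset:
  assumes "finite A" "supp t \<subseteq> A"
  shows "monom_degree t = (\<Sum>x\<in>A. Poly_Mapping.lookup t x)"
  unfolding monom_degree_def using assms
  by (intro sum.mono_neutral_left) (auto simp: in_keys_iff)

lemma monom_degree_add: "monom_degree (s + t) = monom_degree s + monom_degree t"
  by (simp add: monom_degree_superset[of "supp s \<union> supp t"] supp_add_nat lookup_add sum.distrib)

lemma monom_degree_single [simp]: "monom_degree (Poly_Mapping.single x (Suc 0)) = 1"
  by (simp add: monom_degree_def)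

lemma monom_degree_zero [simp]: "monom_degree 0 = 0"
  by (simp add: monom_degree_def)

lemma monom_degree_sum: "monom_degree (sum f A) = (\<Sum>i\<in>A. monom_degree (f i))"
  by (induction A rule: infinite_finite_induct) (auto simp: monom_degree_add)

text \<open>Adding the fixed exponent vector \<open>u\<close> is injective, so the terms of
  \<open>f\<close> are shifted without merging or cancelling.\<close>

lemma lookup_times_monomial:
  "Poly_Mapping.lookup (f * monomial u) (t + u) = Poly_Mapping.lookup f t"
  for f :: "('v, 'k::field) mpoly"
proof -
  have "f * monomial u = (\<Sum>s\<in>supp f. Poly_Mapping.single (s + u) (Poly_Mapping.lookup f s))"
    by (subst sum_monomials[of f]) (simp add: sum_distrib_right mult_single)
  then show ?thesis
    by (simp add: lookup_sum lookup_single when_def in_keys_iff)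
qed

lemma in_supp_times_monomial:
  "t \<in> supp f \<Longrightarrow> t + u \<in> supp (f * monomial u)" for f :: "('v, 'k::field) mpoly"
  by (simp add: in_keys_iff lookup_times_monomial)

lemma in_supp_timesE:
  assumes "t \<in> supp (f * g)"
  obtains a b where "t = a + b" "a \<in> supp f" "b \<in> supp g"
  using assms keys_mult[of f g] by blast

lemma in_supp_times_monomialE:
  fixes f :: "('v, 'k::field) mpoly"
  assumes "t \<in> supp (f * monomial u)"
  obtains s where "t = s + u" "s \<in> supp f"
  using assms by (auto elim: in_supp_timesE)

text \<open>Every term of \<open>f\<close> is charged to one chosen divisor \<open>u i\<close>, and
  \<open>q i\<close> collects the quotients of the terms charged to it. The second conclusion lets
  bounds on variables and degrees pass from \<open>f\<close> to the \<open>q i\<close>.\<close>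

lemma monomial_division:
  fixes f :: "('v, 'k::field) mpoly" and L :: nat
  assumes "\<And>t. t \<in> supp f \<Longrightarrow> \<exists>i<L. \<exists>s. t = s + u i"
  obtains q where "f = (\<Sum>i<L. q i * monomial (u i))"
    and "\<And>i s. i < L \<Longrightarrow> s \<in> supp (q i) \<Longrightarrow> s + u i \<in> supp f"
proof -
  from assms obtain j s where j: "\<And>t. t \<in> supp f \<Longrightarrow> j t < L"
    and js: "\<And>t. t \<in> supp f \<Longrightarrow> t = s t + u (j t)"
    by metis
  define q where "q i = (\<Sum>t\<in>{t \<in> supp f. j t = i}.
      Poly_Mapping.single (s t) (Poly_Mapping.lookup f t))" for i
  have "(\<Sum>i<L. q i * monomial (u i)) =
      (\<Sum>i<L. \<Sum>t\<in>{t \<in> supp f. j t = i}. Poly_Mapping.single t (Poly_Mapping.lookup f t))"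
    unfolding q_def sum_distrib_right
    by (intro sum.cong refl) (use js in \<open>fastforce simp: mult_single\<close>)
  also have "\<dots> = (\<Sum>t\<in>supp f. Poly_Mapping.single t (Poly_Mapping.lookup f t))"
    by (rule sum.group) (auto simp: j)
  finally have "f = (\<Sum>i<L. q i * monomial (u i))" using sum_monomials[of f] by simp
  moreover have "r + u i \<in> supp f" if "i < L" "r \<in> supp (q i)" for i r
  proof -
    from that(2) obtain t where "t \<in> supp f" "j t = i" "r = s t"
      unfolding q_def using supp_sum_subset by (fastforce split: if_splits)
    then show ?thesis using js by metis
  qed
  ultimately show thesis using that by blast
qed

text \<open>
  The set of degrees \<open>D\<close> lets one statement cover all polynomials (\<open>UNIV\<close>) and the homogeneous ones.
\<close>

definition graded_part :: "'v set \<Rightarrow> int set \<Rightarrow> ('v, 'k::field) mpoly set" where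
  "graded_part V D = {p. \<forall>t\<in>supp p. supp t \<subseteq> V \<and> int (monom_degree t) \<in> D}"

lemma graded_part_UNIV: "graded_part V UNIV = carrier (poly_ring V)"
  by (simp add: graded_part_def poly_ring_def)

lemma graded_part_singleton: "graded_part V {e} = poly_component V e"
  by (auto simp: graded_part_def poly_component_def poly_ring_def)

lemma graded_part_mono: "D \<subseteq> E \<Longrightarrow> graded_part V D \<subseteq> graded_part V E"
  by (auto simp: graded_part_def)

lemma graded_part_0 [simp]: "0 \<in> graded_part V D"
  by (simp add: graded_part_def)

lemma graded_part_uminus [simp]: "- p \<in> graded_part V D \<longleftrightarrow> p \<in> graded_part V D"
  by (simp add: graded_part_def in_keys_iff)

lemma graded_part_add:
  "p \<in> graded_part V D \<Longrightarrow> q \<in> graded_part V D \<Longrightarrow> p + q \<in> graded_part V D"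
  using Poly_Mapping.keys_add[of p q] by (auto simp: graded_part_def)

lemma graded_part_sum:
  "(\<And>i. i \<in> A \<Longrightarrow> f i \<in> graded_part V D) \<Longrightarrow> sum f A \<in> graded_part V D"
  by (induction A rule: infinite_finite_induct) (auto intro: graded_part_add)

lemma graded_part_times:
  assumes "p \<in> graded_part V A" "q \<in> graded_part V B" "\<And>a b. a \<in> A \<Longrightarrow> b \<in> B \<Longrightarrow> a + b \<in> C"
  shows "p * q \<in> graded_part V C"
  using assms unfolding graded_part_def
  by (fastforce elim!: in_supp_timesE simp: supp_add_nat monom_degree_add)

lemma graded_part_monomial:
  "supp t \<subseteq> V \<Longrightarrow> int (monom_degree t) \<in> D \<Longrightarrow> Poly_Mapping.single t c \<in> graded_part V D"
  by (auto simp: graded_part_def)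

lemma graded_part_var: "x \<in> V \<Longrightarrow> var x \<in> graded_part V {1}"
  by (simp add: var_def graded_part_def)

text \<open>Division by a variable lowers each degree by one, hence the degree set
  \<open>{d. d + 1 \<in> D}\<close>. Keeping track of it is what later makes coefficients of
  syzygies linear.\<close>

lemma var_division:
  fixes f :: "('v, 'k::field) mpoly"
  assumes "f \<in> graded_part V D" and "\<And>t. t \<in> supp f \<Longrightarrow> supp t \<inter> set xs \<noteq> {}"
  obtains q where "f = (\<Sum>i<length xs. q i * var (xs ! i))"
    and "\<And>i. i < length xs \<Longrightarrow> q i \<in> graded_part V {d. d + 1 \<in> D}"
proof -
  let ?u = "\<lambda>i. Poly_Mapping.single (xs ! i) (1::nat)"
  have "\<exists>i<length xs. \<exists>s. t = s + ?u i" if t: "t \<in> supp f" for t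
  proof -
    from assms(2)[OF t] obtain i where i: "i < length xs" "xs ! i \<in> supp t"
      by (auto simp: in_set_conv_nth)
    \<comment> \<open>Subtraction of exponents is truncated, but \<open>xs ! i\<close> has a
      positive exponent in \<open>t\<close>.\<close>
    have "t = (t - ?u i) + ?u i"
      using i(2) by (intro poly_mapping_eqI)
        (auto simp: lookup_add lookup_minus lookup_single when_def in_keys_iff)
    with i(1) show ?thesis by blast
  qed
  from monomial_division[of f "length xs" ?u, OF this]
  obtain q where q: "f = (\<Sum>i<length xs. q i * monomial (?u i))"
      "\<And>i s. i < length xs \<Longrightarrow> s \<in> supp (q i) \<Longrightarrow> s + ?u i \<in> supp f"
    by blast
  have "q i \<in> graded_part V {d. d + 1 \<in> D}" if "i < length xs" for i
    using q(2)[OF that] assms(1)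
    by (fastforce simp: graded_part_def supp_add_nat monom_degree_add add.commute)
  with q(1) show thesis by (intro that[of q]) (simp_all add: var_def)
qed

lemma sum_lessThan_add:
  "(\<Sum>i<a + b. f i) = (\<Sum>i<a. f i) + (\<Sum>i<b. f (a + i))" for f :: "nat \<Rightarrow> 'a::comm_monoid_add"
  by (induction b) (simp_all add: add.assoc)

subsection \<open>Linear quotients and their syzygies\<close>

text \<open>The zero tail matches the carrier of \<open>free_module\<close>. One degree set serves
  all coordinates because the basis of each free module in a linear resolution lies in a single
  degree.\<close>

definition graded_vectors :: "'v set \<Rightarrow> nat \<Rightarrow> int set \<Rightarrow> (nat \<Rightarrow> ('v, 'k::field) mpoly) set" where
  "graded_vectors V N D = {v. (\<forall>j<N. v j \<in> graded_part V D) \<and> (\<forall>j\<ge>N. v j = 0)}"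

lemma graded_vectors_comp: "v \<in> graded_vectors V N D \<Longrightarrow> v j \<in> graded_part V D"
  by (cases "j < N") (auto simp: graded_vectors_def)

lemma graded_vectors_mono:
  assumes "N \<le> N'" "D \<subseteq> D'" "v \<in> graded_vectors V N D"
  shows "v \<in> graded_vectors V N' D'"
  using assms(1) graded_part_mono[OF assms(2), of V] graded_vectors_comp[OF assms(3)] assms(3)
  by (auto simp: graded_vectors_def)

text \<open>
  The colon ideal of \<open>g 0, \<dots>, g (j - 1)\<close> by \<open>g j\<close> is generated by the variables in \<open>X j\<close>.
  A polynomial lies in an ideal generated by variables iff each of its monomials involves one of them.
\<close>

definition linear_quotients ::
  "'v set \<Rightarrow> nat \<Rightarrow> int \<Rightarrow> nat \<Rightarrow> (nat \<Rightarrow> nat \<Rightarrow> ('v, 'k::field) mpoly) \<Rightarrow> (nat \<Rightarrow> 'v list) \<Rightarrow> bool" where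
  "linear_quotients V N e L g X \<longleftrightarrow> (\<forall>j<L.
     g j \<in> graded_vectors V N {e} \<and> distinct (X j) \<and> set (X j) \<subseteq> V \<and>
     (\<forall>f v. f \<in> graded_part V UNIV \<longrightarrow> v \<in> graded_vectors V j UNIV \<longrightarrow>
        (\<forall>r. f * g j r = (\<Sum>i<j. v i * g i r)) \<longrightarrow> (\<forall>t\<in>supp f. supp t \<inter> set (X j) \<noteq> {})) \<and>
     (\<forall>x\<in>set (X j). \<exists>v\<in>graded_vectors V j {1}. \<forall>r. var x * g j r = (\<Sum>i<j. v i * g i r)))"

text \<open>Induction on the number of generators. The last coordinate of a syzygy lies in the colon
  ideal, so multiples of syzygies whose last coordinate is a variable clear it; what remains is a
  syzygy of the earlier generators. An arbitrary \<open>D\<close> covers both exactness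
  (\<open>D = UNIV\<close>) and the quadratic relations met inside the induction
  (\<open>D = {2}\<close>), whose coefficients must be linear.\<close>

lemma linear_quotients_syzygies:
  fixes g :: "nat \<Rightarrow> nat \<Rightarrow> ('v, 'k::field) mpoly"
  assumes "linear_quotients V N e L g X"
  shows "\<exists>L' g' X'. linear_quotients V L 1 L' g' X' \<and>
     (\<forall>i<L'. \<forall>r. (\<Sum>k<L. g' i k * g k r) = 0) \<and>
     (\<forall>D v. v \<in> graded_vectors V L D \<longrightarrow> (\<forall>r. (\<Sum>k<L. v k * g k r) = 0) \<longrightarrow>
        (\<exists>w\<in>graded_vectors V L' {d. d + 1 \<in> D}. \<forall>k. v k = (\<Sum>i<L'. w i * g' i k)))"
  using assms
proof (induction L)
  case 0
  then show ?case
    by (intro exI[of _ 0]) (auto simp: linear_quotients_def graded_vectors_def)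
next
  case (Suc L)
  have "linear_quotients V N e L g X" using Suc.prems by (simp add: linear_quotients_def)
  from Suc.IH[OF this] obtain L' g' X' where IH1: "linear_quotients V L 1 L' g' X'"
    and IH2: "\<And>i r. i < L' \<Longrightarrow> (\<Sum>k<L. g' i k * g k r) = 0"
    and IH3: "\<And>D v. v \<in> graded_vectors V L D \<Longrightarrow> (\<And>r. (\<Sum>k<L. v k * g k r) = 0) \<Longrightarrow>
        \<exists>w\<in>graded_vectors V L' {d. d + 1 \<in> D}. \<forall>k. v k = (\<Sum>i<L'. w i * g' i k)"
    by blast
  define xs where "xs = X L"
  have xs: "distinct xs" "set xs \<subseteq> V"
    and colon: "\<And>f v t. f \<in> graded_part V UNIV \<Longrightarrow> v \<in> graded_vectors V L UNIV \<Longrightarrow>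
        (\<And>r. f * g L r = (\<Sum>i<L. v i * g i r)) \<Longrightarrow> t \<in> supp f \<Longrightarrow> supp t \<inter> set xs \<noteq> {}"
    and "\<forall>x\<in>set xs. \<exists>v\<in>graded_vectors V L {1}. \<forall>r. var x * g L r = (\<Sum>i<L. v i * g i r)"
    using Suc.prems unfolding linear_quotients_def xs_def by blast+
  then have "\<forall>t. \<exists>v. t < length xs \<longrightarrow> v \<in> graded_vectors V L {1} \<and>
      (\<forall>r. var (xs ! t) * g L r = (\<Sum>i<L. v i * g i r))"
    using nth_mem by blast
  from choice[OF this] obtain c where c: "\<And>t. t < length xs \<Longrightarrow> c t \<in> graded_vectors V L {1}"
    and xc: "\<And>t r. t < length xs \<Longrightarrow> var (xs ! t) * g L r = (\<Sum>i<L. c t i * g i r)"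
    by blast
  have xV: "var (xs ! t) \<in> (graded_part V {1} :: ('v, 'k) mpoly set)" if "t < length xs" for t
    using xs that by (auto intro!: graded_part_var)
  \<comment> \<open>The syzygy with coordinate \<open>xs ! t\<close> at \<open>L\<close>, read off
    from the expression of \<open>var (xs ! t) * g L\<close> through the earlier generators.\<close>
  define \<sigma> where "\<sigma> t k = (if k = L then var (xs ! t) else - c t k)" for t k
  have \<sigma>_vec: "\<sigma> t \<in> graded_vectors V (Suc L) {1}" if "t < length xs" for t
    using c[OF that] xV[OF that] by (auto simp: graded_vectors_def \<sigma>_def)
  have \<sigma>_syz: "(\<Sum>k<Suc L. \<sigma> t k * g k r) = 0" if "t < length xs" for t r
    using xc[OF that, of r] by (simp add: \<sigma>_def sum_negf)
  define L'' where "L'' = L' + length xs"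
  define g'' where "g'' i = (if i < L' then g' i else \<sigma> (i - L'))" for i
  \<comment> \<open>Old syzygies come first and keep their colon ideals. For
    \<open>\<sigma> t\<close> only coordinate \<open>L\<close> matters, which leaves the variables
    listed before \<open>xs ! t\<close>.\<close>
  define X'' where "X'' i = (if i < L' then X' i else take (i - L') xs)" for i
  have g': "g' i \<in> graded_vectors V L {1}" if "i < L'" for i
    using IH1 that by (simp add: linear_quotients_def)
  have g'L: "g' i L = 0" if "i < L'" for i
    using g'[OF that] by (simp add: graded_vectors_def)
  have split: "(\<Sum>i<L' + t. v i * g'' i k) = (\<Sum>i<L'. v i * g' i k) + (\<Sum>i<t. v (L' + i) * \<sigma> i k)"
    for v t k
    by (simp add: sum_lessThan_add g''_def)
  have "linear_quotients V (Suc L) 1 L'' g'' X''"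
    unfolding linear_quotients_def
  proof (intro allI impI)
    fix i assume i: "i < L''"
    show "g'' i \<in> graded_vectors V (Suc L) {1} \<and> distinct (X'' i) \<and> set (X'' i) \<subseteq> V \<and>
     (\<forall>f v. f \<in> graded_part V UNIV \<longrightarrow> v \<in> graded_vectors V i UNIV \<longrightarrow>
        (\<forall>r. f * g'' i r = (\<Sum>k<i. v k * g'' k r)) \<longrightarrow> (\<forall>t\<in>supp f. supp t \<inter> set (X'' i) \<noteq> {})) \<and>
     (\<forall>x\<in>set (X'' i). \<exists>v\<in>graded_vectors V i {1}. \<forall>r. var x * g'' i r = (\<Sum>k<i. v k * g'' k r))"
    proof (cases "i < L'")
      case True
      have "(\<Sum>k<i. v k * g'' k r) = (\<Sum>k<i. v k * g' k r)" for v r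
        using True by (intro sum.cong) (auto simp: g''_def)
      moreover have "g'' i = g' i" "X'' i = X' i" using True by (auto simp: g''_def X''_def)
      moreover have "g' i \<in> graded_vectors V (Suc L) {1}"
        using g'[OF True] by (rule graded_vectors_mono[rotated 2]) auto
      ultimately show ?thesis using IH1 True unfolding linear_quotients_def by simp
    next
      case False
      then obtain t where t: "i = L' + t" "t < length xs"
        using i unfolding L''_def by (metis add_diff_inverse_nat nat_add_left_cancel_less)
      have g''i: "g'' i = \<sigma> t" and X''i: "X'' i = take t xs"
        by (simp_all add: g''_def X''_def t)
      have "supp s \<inter> set (take t xs) \<noteq> {}"
        if f: "f \<in> graded_part V UNIV" and v: "v \<in> graded_vectors V i UNIV"
          and eq: "\<forall>r. f * g'' i r = (\<Sum>k<i. v k * g'' k r)" and s: "s \<in> supp f" for f v s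
      proof -
        \<comment> \<open>Compare coordinate \<open>L\<close>, in which all old syzygies
          vanish.\<close>
        have "f * var (xs ! t) = (\<Sum>k<t. v (L' + k) * var (xs ! k))"
          using eq[rule_format, of L] unfolding g''i t(1) split by (simp add: g'L g''_def \<sigma>_def)
        moreover have "s + Poly_Mapping.single (xs ! t) 1 \<in> supp (f * var (xs ! t))"
          unfolding var_def by (rule in_supp_times_monomial[OF s])
        ultimately obtain k where k: "k < t"
          "s + Poly_Mapping.single (xs ! t) 1 \<in> supp (v (L' + k) * var (xs ! k))"
          using supp_sum_subset[of "\<lambda>k. v (L' + k) * var (xs ! k)" "{..<t}"] by auto
        then obtain s' where "s + Poly_Mapping.single (xs ! t) 1 = s' + Poly_Mapping.single (xs ! k) 1"
          unfolding var_def by (auto elim: in_supp_times_monomialE)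
        \<comment> \<open>Some earlier variable \<open>xs ! k\<close> divides the product of
          \<open>s\<close> and \<open>xs ! t\<close>; since the variables are distinct, it divides
          \<open>s\<close>.\<close>
        then have "xs ! k \<in> supp (s + Poly_Mapping.single (xs ! t) (1::nat))"
          by (simp add: supp_add_nat)
        moreover have "xs ! k \<noteq> xs ! t"
          using k(1) t(2) xs(1) by (simp add: nth_eq_iff_index_eq)
        ultimately have "xs ! k \<in> supp s" by (simp add: supp_add_nat)
        moreover have "xs ! k \<in> set (take t xs)" using k(1) t(2) by (auto simp: in_set_conv_nth)
        ultimately show ?thesis by blast
      qed
      moreover have "\<exists>v\<in>graded_vectors V i {1}. \<forall>r. var x * g'' i r = (\<Sum>k<i. v k * g'' k r)"
        if x: "x \<in> set (take t xs)" for x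
      proof -
        obtain p where p: "p < t" "x = xs ! p" using x by (auto simp: in_set_conv_nth)
        have pl: "p < length xs" using p t by simp
        \<comment> \<open>With \<open>x = xs ! p\<close>, the coordinates at \<open>L\<close>
          cancel. Thus \<open>u\<close> is a syzygy of the first \<open>L\<close> generators with
          quadratic coordinates, and the induction hypothesis expresses it by old syzygies with
          linear coefficients.\<close>
        define u where "u k = var x * \<sigma> t k - var (xs ! t) * \<sigma> p k" for k
        have "u k \<in> graded_part V {2}" for k
          unfolding u_def diff_conv_add_uminus graded_part_uminus p(2)
          by (intro graded_part_add graded_part_uminus[THEN iffD2])
            (rule graded_part_times[OF xV graded_vectors_comp[OF \<sigma>_vec]], use t pl in auto)+
        moreover have "u k = 0" if "k \<ge> L" for k
          using that \<sigma>_vec[OF t(2)] \<sigma>_vec[OF pl] by (cases "k = L") (auto simp: u_def \<sigma>_def p graded_vectors_def)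
        ultimately have uv: "u \<in> graded_vectors V L {2}" by (simp add: graded_vectors_def)
        have "(\<Sum>k<L. u k * g k r) = 0" for r
        proof -
          have "(\<Sum>k<L. u k * g k r) = (\<Sum>k<Suc L. u k * g k r)" using \<open>\<And>k. k \<ge> L \<Longrightarrow> u k = 0\<close> by simp
          also have "\<dots> = var x * (\<Sum>k<Suc L. \<sigma> t k * g k r) - var (xs ! t) * (\<Sum>k<Suc L. \<sigma> p k * g k r)"
            unfolding u_def sum_distrib_left sum_subtractf[symmetric] by (simp add: algebra_simps)
          finally show ?thesis using \<sigma>_syz[OF t(2)] \<sigma>_syz[OF pl] by simp
        qed
        from IH3[OF uv this] obtain w where w: "w \<in> graded_vectors V L' {1}"
          "\<And>k. u k = (\<Sum>i<L'. w i * g' i k)" by auto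
        \<comment> \<open>The definition of \<open>u\<close> reads
          \<open>x * \<sigma> t = u + var (xs ! t) * \<sigma> p\<close>, and
          \<open>\<sigma> p\<close> has index \<open>L' + p\<close>.\<close>
        define v where "v k = (if k < L' then w k else if k = L' + p then var (xs ! t) else 0)" for k
        have "v \<in> graded_vectors V i {1}"
          using w(1) xV[OF t(2)] p t by (auto simp: graded_vectors_def v_def)
        moreover have "var x * g'' i r = (\<Sum>k<i. v k * g'' k r)" for r
        proof -
          have "(\<Sum>k<t. v (L' + k) * \<sigma> k r) = (\<Sum>k<t. if k = p then var (xs ! t) * \<sigma> k r else 0)"
            by (intro sum.cong) (auto simp: v_def)
          also have "\<dots> = var (xs ! t) * \<sigma> p r" using p(1) by simp
          moreover have "(\<Sum>i<L'. v i * g' i r) = u r" by (simp add: v_def w(2))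
          ultimately show ?thesis unfolding t(1) split by (simp add: g''_def u_def)
        qed
        ultimately show ?thesis by blast
      qed
      ultimately show ?thesis
        using \<sigma>_vec[OF t(2)] xs set_take_subset[of t xs] unfolding g''i X''i by (auto simp: distinct_take)
    qed
  qed
  moreover have "(\<Sum>k<Suc L. g'' i k * g k r) = 0" if "i < L''" for i r
  proof (cases "i < L'")
    case True
    then show ?thesis using IH2[OF True] g'L[OF True] by (simp add: g''_def)
  next
    case False
    then show ?thesis using \<sigma>_syz[of "i - L'"] that by (simp add: g''_def L''_def)
  qed
  moreover have "\<exists>w\<in>graded_vectors V L'' {d. d + 1 \<in> D}. \<forall>k. v k = (\<Sum>i<L''. w i * g'' i k)"
    if v: "v \<in> graded_vectors V (Suc L) D" and syz: "\<forall>r. (\<Sum>k<Suc L. v k * g k r) = 0" for D v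
  proof -
    have "supp t \<inter> set xs \<noteq> {}" if t: "t \<in> supp (v L)" for t
    \<comment> \<open>Solving the syzygy for \<open>v L * g L\<close> puts \<open>v L\<close> into
      the colon ideal.\<close>
    proof (rule colon[OF _ _ _ t])
      show "v L \<in> graded_part V UNIV"
        using graded_vectors_comp[OF v, of L] graded_part_mono[of D UNIV V] by auto
      show "(\<lambda>k. if k < L then - v k else 0) \<in> graded_vectors V L UNIV"
        using graded_vectors_comp[OF v] graded_part_mono[of D UNIV V] by (auto simp: graded_vectors_def)
      show "v L * g L r = (\<Sum>i<L. (if i < L then - v i else 0) * g i r)" for r
        using syz[rule_format, of r] by (simp add: sum_negf eq_neg_iff_add_eq_0 add.commute)
    qed
    from var_division[OF graded_vectors_comp[OF v] this]
    obtain q where q: "v L = (\<Sum>t<length xs. q t * var (xs ! t))"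
      and qD: "\<And>t. t < length xs \<Longrightarrow> q t \<in> graded_part V {d. d + 1 \<in> D}" by blast
    \<comment> \<open>The choice of \<open>q\<close> makes coordinate \<open>L\<close> vanish;
      subtracting syzygies leaves a syzygy, and the degrees stay in \<open>D\<close>.\<close>
    define v' where "v' k = v k - (\<Sum>t<length xs. q t * \<sigma> t k)" for k
    have v'0: "v' k = 0" if "k \<ge> L" for k
    proof (cases "k = L")
      case True
      then show ?thesis by (simp add: v'_def q \<sigma>_def)
    next
      case False
      then have "k \<ge> Suc L" using that by simp
      then show ?thesis using v \<sigma>_vec by (simp add: v'_def graded_vectors_def)
    qed
    have "v' k \<in> graded_part V D" for k
      unfolding v'_def diff_conv_add_uminus
      by (intro graded_part_add graded_part_uminus[THEN iffD2] graded_vectors_comp[OF v] graded_part_sum)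
        (rule graded_part_times[OF qD graded_vectors_comp[OF \<sigma>_vec]], auto)
    with v'0 have v': "v' \<in> graded_vectors V L D" by (simp add: graded_vectors_def)
    have "(\<Sum>k<L. v' k * g k r) = 0" for r
    proof -
      have "(\<Sum>k<L. v' k * g k r) = (\<Sum>k<Suc L. v' k * g k r)" by (simp add: v'0)
      also have "\<dots> = (\<Sum>k<Suc L. v k * g k r) - (\<Sum>k<Suc L. \<Sum>t<length xs. q t * \<sigma> t k * g k r)"
        unfolding v'_def left_diff_distrib sum_subtractf sum_distrib_right ..
      also have "(\<Sum>k<Suc L. \<Sum>t<length xs. q t * \<sigma> t k * g k r) =
          (\<Sum>t<length xs. q t * (\<Sum>k<Suc L. \<sigma> t k * g k r))"
        unfolding sum_distrib_left by (subst sum.swap) (simp add: mult.assoc)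
      finally show ?thesis using syz \<sigma>_syz by simp
    qed
    from IH3[OF v' this] obtain w where w: "w \<in> graded_vectors V L' {d. d + 1 \<in> D}"
      "\<And>k. v' k = (\<Sum>i<L'. w i * g' i k)" by blast
    define w' where "w' i = (if i < L' then w i else if i < L'' then q (i - L') else 0)" for i
    have "w' \<in> graded_vectors V L'' {d. d + 1 \<in> D}"
      using w(1) qD by (auto simp: graded_vectors_def w'_def L''_def)
    moreover have "v k = (\<Sum>i<L''. w' i * g'' i k)" for k
    proof -
      have "(\<Sum>i<L''. w' i * g'' i k) = v' k + (\<Sum>t<length xs. q t * \<sigma> t k)"
        unfolding L''_def split w(2) by (simp add: w'_def L''_def)
      then show ?thesis by (simp add: v'_def)
    qed
    ultimately show ?thesis by blast
  qed
  ultimately show ?case by blast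
qed

subsection \<open>The linear resolution\<close>

text \<open>Multiplication by the matrix with rows \<open>g k\<close>. It serves for all
  differentials and, read in coordinate 0, for the augmentation.\<close>

definition lincomb ::
  "nat \<Rightarrow> (nat \<Rightarrow> nat \<Rightarrow> ('v, 'k::field) mpoly) \<Rightarrow> (nat \<Rightarrow> ('v, 'k) mpoly) \<Rightarrow> nat \<Rightarrow> ('v, 'k) mpoly" where
  "lincomb L g v = (\<lambda>r. \<Sum>k<L. v k * g k r)"

lemma lincomb_graded:
  assumes "\<And>k. k < L \<Longrightarrow> g k \<in> graded_vectors V N {e}" "v \<in> graded_vectors V L D"
    and "\<And>d. d \<in> D \<Longrightarrow> d + e \<in> D'"
  shows "lincomb L g v \<in> graded_vectors V N D'"
proof -
  have "v k * g k r \<in> graded_part V D'" if "k < L" for k r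
    using graded_part_times[OF graded_vectors_comp[OF assms(2)] graded_vectors_comp[OF assms(1)[OF that]]]
      assms(3) by blast
  then show ?thesis using assms(1) by (auto simp: graded_vectors_def lincomb_def intro!: graded_part_sum)
qed

lemma lincomb_add: "lincomb L g (\<lambda>j. u j + v j) = (\<lambda>r. lincomb L g u r + lincomb L g v r)"
  by (simp add: lincomb_def distrib_right sum.distrib)

lemma lincomb_smult: "lincomb L g (\<lambda>j. c * v j) = (\<lambda>r. c * lincomb L g v r)"
  by (simp add: lincomb_def sum_distrib_left mult.assoc)

lemma carrier_free_module: "carrier (free_module (poly_ring V) b) = graded_vectors V b UNIV"
  by (simp add: free_module_def graded_vectors_def graded_part_UNIV poly_ring_simps(5))

lemma shifted_component_replicate:
  "shifted_component V (replicate b c) e = graded_vectors V b {e - c}"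
  using graded_part_mono[of "{e - c}" UNIV V]
  by (auto simp: shifted_component_def carrier_free_module graded_vectors_def graded_part_singleton)

lemma free_module_simps:
  "u \<oplus>\<^bsub>free_module (poly_ring V) b\<^esub> v = (\<lambda>j. u j + v j)"
  "c \<odot>\<^bsub>free_module (poly_ring V) b\<^esub> v = (\<lambda>j. c * v j)"
  "\<zero>\<^bsub>free_module (poly_ring V) b\<^esub> = (\<lambda>j. 0)"
  by (simp_all add: free_module_def poly_ring_simps)

lemma self_module_simps:
  "carrier (self_module (poly_ring V)) = graded_part V UNIV"
  "u \<oplus>\<^bsub>self_module (poly_ring V)\<^esub> v = u + v"
  "c \<odot>\<^bsub>self_module (poly_ring V)\<^esub> v = c * v"
  "\<zero>\<^bsub>self_module (poly_ring V)\<^esub> = 0"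
  by (simp_all add: self_module_def poly_ring_simps(2-) graded_part_UNIV)

lemma linear_map_lincomb:
  assumes "\<And>k. k < L \<Longrightarrow> g k \<in> graded_vectors V N {e}"
  shows "linear_map (poly_ring V) (free_module (poly_ring V) L) (free_module (poly_ring V) N) (lincomb L g)"
  unfolding linear_map_def carrier_free_module free_module_simps lincomb_add lincomb_smult
  using lincomb_graded[OF assms] by auto

lemma a_kernel_free_module:
  "a_kernel (free_module (poly_ring V) b) M h = {v \<in> graded_vectors V b UNIV. h v = \<zero>\<^bsub>M\<^esub>}"
  by (simp add: a_kernel_def kernel_def carrier_free_module)

lemma ideal_sum_closed:
  assumes "ideal I (poly_ring V)" "\<And>i. i \<in> A \<Longrightarrow> f i \<in> I"
  shows "(\<Sum>i\<in>A. f i) \<in> I"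
proof -
  have "additive_subgroup I (poly_ring V)" using assms(1) by (rule ideal.axioms(1))
  then show ?thesis using assms(2) additive_subgroup.zero_closed additive_subgroup.a_closed
    by (induction A rule: infinite_finite_induct) (fastforce simp: poly_ring_simps(2-))+
qed

text \<open>A monomial of positive degree contains a variable, so \<open>var_division\<close>
  applies. This is the form in which minimality is checked.\<close>

lemma graded_part_pos_irrelevant:
  fixes p :: "('v, 'k::field) mpoly"
  assumes "p \<in> graded_part V {d. d > 0}"
  shows "p \<in> irrelevant_ideal V"
proof -
  interpret cring "poly_ring V :: ('v, 'k) mpoly ring" by (rule poly_ring_cring)
  have sub: "var ` V \<subseteq> carrier (poly_ring V :: ('v, 'k) mpoly ring)"
    by (auto intro: var_in_poly_ring)
  interpret I: ideal "irrelevant_ideal V :: ('v, 'k) mpoly set" "poly_ring V"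
    unfolding irrelevant_ideal_def by (rule genideal_ideal[OF sub])
  \<comment> \<open>\<open>V\<close> may be infinite; only the finitely many variables that occur in
    \<open>p\<close> are listed.\<close>
  obtain xs where xs: "set xs = (\<Union>t\<in>supp p. supp t)"
    using finite_list[of "\<Union>t\<in>supp p. supp t"] by auto
  have "supp t \<inter> set xs \<noteq> {}" if "t \<in> supp p" for t
  proof -
    have "supp t \<noteq> {}" using assms that by (auto simp: graded_part_def)
    then show ?thesis using that unfolding xs by blast
  qed
  from var_division[OF assms this] obtain q where q: "p = (\<Sum>i<length xs. q i * var (xs ! i))"
    "\<And>i. i < length xs \<Longrightarrow> q i \<in> graded_part V {d. d + 1 \<in> {d. d > 0}}" by blast
  show ?thesis unfolding q(1)
  proof (rule ideal_sum_closed[OF I.is_ideal])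
    fix i assume i: "i \<in> {..<length xs}"
    have qi: "q i \<in> carrier (poly_ring V)"
      using q(2)[of i] i graded_part_mono[of _ UNIV V] unfolding graded_part_UNIV[symmetric] by blast
    have "set xs \<subseteq> V" using assms unfolding xs by (auto simp: graded_part_def)
    with i have "xs ! i \<in> V" by (meson lessThan_iff nth_mem subsetD)
    then have "var (xs ! i) \<in> (irrelevant_ideal V :: (_, 'k) mpoly set)"
      unfolding irrelevant_ideal_def by (intro subsetD[OF genideal_self[OF sub]] imageI)
    from I.I_l_closed[OF this qi] show "q i * var (xs ! i) \<in> irrelevant_ideal V"
      by (simp add: poly_ring_simps(2))
  qed
qed

text \<open>The syzygies of a sequence with linear quotients again form such a sequence after a
  choice of generators, so \<open>linear_quotients_syzygies\<close> can be iterated. Each round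
  supplies the next differential as a matrix of linear forms.\<close>

theorem linear_quotients_linear_resolution:
  fixes g :: "nat \<Rightarrow> nat \<Rightarrow> ('v, 'k::field) mpoly"
  assumes "linear_quotients V 1 (int d) L g X"
  shows "has_linear_free_resolution V d ((\<lambda>v. lincomb L g v 0) ` graded_vectors V L UNIV)"
proof -
  define syz where "syz L g L' g' \<longleftrightarrow>
     (\<forall>i<L'. \<forall>r. (\<Sum>k<L. g' i k * g k r) = 0) \<and>
     (\<forall>D v. v \<in> graded_vectors V L D \<longrightarrow> (\<forall>r. (\<Sum>k<L. v k * g k r) = 0) \<longrightarrow>
        (\<exists>w\<in>graded_vectors V L' {d. d + 1 \<in> D}. \<forall>k. v k = (\<Sum>i<L'. w i * g' i k)))"
    for L and g :: "nat \<Rightarrow> nat \<Rightarrow> ('v, 'k) mpoly" and L' g'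
  \<comment> \<open>The state at stage \<open>n\<close> consists of the ambient rank, the number of
    generators, the generators and the colon variables. Only stage 0 has degree \<open>d\<close>;
    later generators have linear coordinates. In \<open>Q\<close> the number of generators at one
    stage becomes the ambient rank of the next.\<close>
  define P where "P n = (\<lambda>(N, L', g', X'). linear_quotients V N (if n = 0 then int d else 1) L' g' X'
      \<and> (n = 0 \<longrightarrow> N = 1 \<and> L' = L \<and> g' = g))" for n :: nat
  define Q where "Q (n::nat) = (\<lambda>(N::nat, L, g, X::nat \<Rightarrow> 'v list) (N', L', g', X'::nat \<Rightarrow> 'v list).
      N' = L \<and> syz L g L' g')" for n
  have "\<exists>f. \<forall>n. P n (f n) \<and> Q n (f n) (f (Suc n))"
  proof (rule dependent_nat_choice)
    show "\<exists>x. P 0 x" using assms by (auto simp: P_def)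
  next
    fix x n assume "P n x"
    then obtain N L1 g1 X1 where x: "x = (N, L1, g1, X1)"
      and "linear_quotients V N (if n = 0 then int d else 1) L1 g1 X1"
      unfolding P_def by (cases x) auto
    from linear_quotients_syzygies[OF this(2)] obtain L' g' X' where
      "linear_quotients V L1 1 L' g' X'" "syz L1 g1 L' g'"
      unfolding syz_def by blast
    then show "\<exists>y. P (Suc n) y \<and> Q n x y"
      unfolding x P_def Q_def by (intro exI[of _ "(L1, L', g', X')"]) simp
  qed
  then obtain f where f: "\<And>n. P n (f n)" "\<And>n. Q n (f n) (f (Suc n))" by blast
  define N where "N n = fst (f n)" for n
  define b where "b n = fst (snd (f n))" for n
  define h where "h n = fst (snd (snd (f n)))" for n
  have lq: "linear_quotients V (N n) (if n = 0 then int d else 1) (b n) (h n) (snd (snd (snd (f n))))"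
    and f0: "N 0 = 1" "b 0 = L" "h 0 = g" and N: "N (Suc n) = b n"
    and syz: "syz (b n) (h n) (b (Suc n)) (h (Suc n))" for n
    using f(1)[of n] f(1)[of 0] f(2)[of n] by (auto simp: P_def Q_def N_def b_def h_def split_beta)
  have h0: "g k \<in> graded_vectors V 1 {int d}" if "k < L" for k
    using lq[of 0] that by (simp add: linear_quotients_def f0)
  have h: "h (Suc n) k \<in> graded_vectors V (b n) {1}" if "k < b (Suc n)" for k n
    using lq[of "Suc n"] that by (simp add: linear_quotients_def N)
  define a where "a n = replicate (b n) (int d + int n)" for n
  define \<epsilon> where "\<epsilon> v = lincomb L g v 0" for v
  define \<delta> where "\<delta> n = lincomb (b n) (h n)" for n
  let ?S = "poly_ring V :: ('v, 'k) mpoly ring"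
  have len: "length (a n) = b n" for n by (simp add: a_def)
  have \<epsilon>_graded: "\<epsilon> v \<in> graded_part V D'" if "v \<in> graded_vectors V L D" "\<And>c. c \<in> D \<Longrightarrow> c + int d \<in> D'"
    for v D D'
    unfolding \<epsilon>_def using lincomb_graded[OF h0 that] by (rule graded_vectors_comp)
  \<comment> \<open>The first half of \<open>syz\<close> gives composition zero; the second half
    with \<open>D = UNIV\<close> gives preimages of kernel elements.\<close>
  have exact: "\<delta> (Suc n) ` graded_vectors V (b (Suc n)) UNIV =
      {v \<in> graded_vectors V (b n) UNIV. lincomb (b n) (h n) v = (\<lambda>r. 0)}" for n
  proof (intro equalityI subsetI)
    fix v assume "v \<in> \<delta> (Suc n) ` graded_vectors V (b (Suc n)) UNIV"
    then obtain w where w: "w \<in> graded_vectors V (b (Suc n)) UNIV" "v = lincomb (b (Suc n)) (h (Suc n)) w"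
      unfolding \<delta>_def by blast
    have "v \<in> graded_vectors V (b n) UNIV"
      unfolding w(2) by (rule lincomb_graded[OF h w(1)]) auto
    moreover have "lincomb (b n) (h n) v r = 0" for r
    proof -
      have "lincomb (b n) (h n) v r = (\<Sum>i<b (Suc n). w i * (\<Sum>k<b n. h (Suc n) i k * h n k r))"
        unfolding w(2) lincomb_def sum_distrib_right sum_distrib_left
        by (subst sum.swap) (simp add: mult.assoc)
      then show ?thesis using syz[of n] by (simp add: syz_def)
    qed
    ultimately show "v \<in> {v \<in> graded_vectors V (b n) UNIV. lincomb (b n) (h n) v = (\<lambda>r. 0)}" by auto
  next
    fix v assume "v \<in> {v \<in> graded_vectors V (b n) UNIV. lincomb (b n) (h n) v = (\<lambda>r. 0)}"
    then have "v \<in> graded_vectors V (b n) UNIV" "\<forall>r. (\<Sum>k<b n. v k * h n k r) = 0"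
      by (auto simp: lincomb_def fun_eq_iff)
    then obtain w where "w \<in> graded_vectors V (b (Suc n)) {d. d + 1 \<in> UNIV}"
      "\<forall>k. v k = (\<Sum>i<b (Suc n). w i * h (Suc n) i k)"
      using syz[of n] unfolding syz_def by blast
    then show "v \<in> \<delta> (Suc n) ` graded_vectors V (b (Suc n)) UNIV"
      by (intro image_eqI[of _ _ w]) (auto simp: \<delta>_def lincomb_def)
  qed
  have "graded_free_resolution V (\<epsilon> ` graded_vectors V L UNIV) a \<epsilon> \<delta>"
    unfolding graded_free_resolution_def Let_def len carrier_free_module a_kernel_free_module
      free_module_simps self_module_simps f0
  proof (intro conjI allI)
    show "linear_map ?S (free_module ?S L) (self_module ?S) \<epsilon>"
      unfolding linear_map_def carrier_free_module free_module_simps self_module_simps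
      using \<epsilon>_graded by (auto simp: \<epsilon>_def lincomb_add lincomb_smult)
    show "\<epsilon> ` shifted_component V (a 0) e \<subseteq> poly_component V e" for e
      unfolding a_def shifted_component_replicate f0 graded_part_singleton[symmetric]
      by (auto intro!: \<epsilon>_graded)
    show "linear_map ?S (free_module ?S (b (Suc i))) (free_module ?S (b i)) (\<delta> (Suc i))" for i
      unfolding \<delta>_def by (rule linear_map_lincomb[OF h])
    show "\<delta> (Suc i) ` shifted_component V (a (Suc i)) e \<subseteq> shifted_component V (a i) e" for i e
      unfolding a_def shifted_component_replicate \<delta>_def by (auto intro!: lincomb_graded[OF h])
    show "\<epsilon> ` graded_vectors V L UNIV = \<epsilon> ` graded_vectors V L UNIV" ..
    \<comment> \<open>Stage 0 has ambient rank 1, so coordinate 0 alone decides whether the vector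
      vanishes.\<close>
    have "lincomb L g v = (\<lambda>r. 0) \<longleftrightarrow> \<epsilon> v = 0" if "v \<in> graded_vectors V L UNIV" for v
    proof -
      have "lincomb L g v \<in> graded_vectors V 1 UNIV" by (rule lincomb_graded[OF h0 that]) auto
      then have "lincomb L g v r = 0" if "r \<noteq> 0" for r using that by (simp add: graded_vectors_def)
      then show ?thesis unfolding \<epsilon>_def fun_eq_iff by metis
    qed
    then show "\<delta> 1 ` graded_vectors V (b 1) UNIV = {v \<in> graded_vectors V L UNIV. \<epsilon> v = 0}"
      using exact[of 0] by (auto simp: f0)
    show "\<delta> (Suc (Suc i)) ` graded_vectors V (b (Suc (Suc i))) UNIV =
        {v \<in> graded_vectors V (b (Suc i)) UNIV. \<delta> (Suc i) v = (\<lambda>j. 0)}" for i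
      using exact[of "Suc i"] by (simp add: \<delta>_def)
  qed
  moreover have "\<delta> (Suc i) v j \<in> irrelevant_ideal V" if "v \<in> graded_vectors V (b (Suc i)) UNIV" for i v j
  proof -
    \<comment> \<open>The matrix entries have degree 1 and terms of \<open>v\<close> have degree at
      least 0, so every term of the image has positive degree.\<close>
    have "lincomb (b (Suc i)) (h (Suc i)) v \<in> graded_vectors V (b i) {d. d > 0}"
    proof (rule lincomb_graded[OF h])
      show "v \<in> graded_vectors V (b (Suc i)) {d. d \<ge> 0}"
        using that by (auto simp: graded_vectors_def graded_part_def)
    qed auto
    then show ?thesis unfolding \<delta>_def by (intro graded_part_pos_irrelevant graded_vectors_comp)
  qed
  ultimately have "minimal_graded_free_resolution V (\<epsilon> ` graded_vectors V L UNIV) a \<epsilon> \<delta>"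
    unfolding minimal_graded_free_resolution_def len carrier_free_module by blast
  then show ?thesis
    unfolding has_linear_free_resolution_def \<epsilon>_def[symmetric]
    by (intro exI[of _ a] exI[of _ \<epsilon>] exI[of _ \<delta>]) (simp add: a_def)
qed

subsection \<open>Monomial ideals\<close>

text \<open>Membership is encoded term by term through divisibility, which makes it checkable on
  supports. \<open>Idl_monomials\<close> identifies this set with the generated ideal.\<close>

definition monomial_ideal :: "'v set \<Rightarrow> ('v \<Rightarrow>\<^sub>0 nat) set \<Rightarrow> ('v, 'k::field) mpoly set" where
  "monomial_ideal V T = {p \<in> carrier (poly_ring V). \<forall>t\<in>supp p. \<exists>u\<in>T. \<exists>s. t = s + u}"

text \<open>The colon ideal at \<open>j\<close> is generated by the quotients of the earlier
  \<open>u i\<close> by their gcd with \<open>u j\<close>. The exchange variable \<open>x\<close>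
  divides such a quotient, having a larger exponent in \<open>u i\<close> than in
  \<open>u j\<close>, and it lies in the colon ideal because \<open>x\<close> times
  \<open>u j\<close> equals \<open>y\<close> times \<open>u k\<close>.\<close>

lemma monomial_linear_quotients:
  fixes u :: "nat \<Rightarrow> 'v \<Rightarrow>\<^sub>0 nat"
  assumes V: "\<And>j. j < L \<Longrightarrow> supp (u j) \<subseteq> V"
    and d: "\<And>j. j < L \<Longrightarrow> monom_degree (u j) = d"
    and exchange: "\<And>i j. i < j \<Longrightarrow> j < L \<Longrightarrow> \<exists>k<j. \<exists>x y.
      u k + Poly_Mapping.single y 1 = u j + Poly_Mapping.single x 1 \<and>
      Poly_Mapping.lookup (u j) x < Poly_Mapping.lookup (u i) x"
  shows "\<exists>X. linear_quotients V 1 (int d) L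
    (\<lambda>j r. if r = 0 then monomial (u j) else 0 :: ('v, 'k::field) mpoly) X"
proof -
  \<comment> \<open>The restriction to variables of the generators makes \<open>Y j\<close> finite
    and contained in \<open>V\<close>. No exchange variable is lost, since it occurs in
    \<open>u i\<close>.\<close>
  define Y where "Y j = {x \<in> (\<Union>i<L. supp (u i)).
      \<exists>k<j. \<exists>y. u k + Poly_Mapping.single y 1 = u j + Poly_Mapping.single x 1}" for j
  have "finite (Y j)" for j by (rule finite_subset[of _ "\<Union>i<L. supp (u i)"]) (auto simp: Y_def)
  then have "\<forall>j. \<exists>xs. set xs = Y j \<and> distinct xs" by (simp add: finite_distinct_list)
  from choice[OF this] obtain X where X: "\<And>j. set (X j) = Y j" "\<And>j. distinct (X j)" by blast
  have YV: "Y j \<subseteq> V" for j using V by (auto simp: Y_def)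
  define g :: "nat \<Rightarrow> nat \<Rightarrow> ('v, 'k) mpoly"
    where "g = (\<lambda>j r. if r = 0 then monomial (u j) else 0)"
  have "linear_quotients V 1 (int d) L g X"
    unfolding linear_quotients_def
  proof (intro allI impI conjI ballI)
    fix j assume j: "j < L"
    show "g j \<in> graded_vectors V 1 {int d}"
      using V[OF j] d[OF j] by (auto simp: graded_vectors_def g_def intro: graded_part_monomial)
    show "distinct (X j)" "set (X j) \<subseteq> V" using X YV by auto
    show "supp t \<inter> set (X j) \<noteq> {}"
      if eq: "\<forall>r. f * g j r = (\<Sum>i<j. v i * g i r)" and t: "t \<in> supp f" for f v t
    proof -
      have "f * monomial (u j) = (\<Sum>i<j. v i * monomial (u i))" using eq[rule_format, of 0] by (simp add: g_def)
      with in_supp_times_monomial[OF t, of "u j"] obtain i where i: "i < j" "t + u j \<in> supp (v i * monomial (u i))"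
        using supp_sum_subset[of "\<lambda>i. v i * monomial (u i)" "{..<j}"] by auto
      then obtain s where s: "t + u j = s + u i" by (auto elim: in_supp_times_monomialE)
      obtain k x y where k: "k < j" and xy: "u k + Poly_Mapping.single y 1 = u j + Poly_Mapping.single x 1"
        and less: "Poly_Mapping.lookup (u j) x < Poly_Mapping.lookup (u i) x"
        using exchange[OF i(1) j] by blast
      \<comment> \<open>Comparing exponents of \<open>x\<close> in \<open>t + u j = s + u i\<close>
        shows that \<open>x\<close> divides \<open>t\<close>.\<close>
      have "Poly_Mapping.lookup t x + Poly_Mapping.lookup (u j) x
          = Poly_Mapping.lookup s x + Poly_Mapping.lookup (u i) x"
        using s by (metis lookup_add)
      with less have "x \<in> supp t" by (simp add: in_keys_iff)
      moreover have "x \<in> supp (u i)" using less by (simp add: in_keys_iff)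
      then have "x \<in> Y j" unfolding Y_def using k xy i(1) j less_trans by blast
      ultimately show ?thesis using X by blast
    qed
    show "\<exists>v\<in>graded_vectors V j {1}. \<forall>r. var x * g j r = (\<Sum>i<j. v i * g i r)" if x: "x \<in> set (X j)" for x
    proof -
      obtain k y where k: "k < j" and xy: "u k + Poly_Mapping.single y 1 = u j + Poly_Mapping.single x 1"
        using x unfolding X Y_def by blast
      \<comment> \<open>\<open>y\<close> divides the product of \<open>x\<close> and
        \<open>u j\<close>, hence lies in \<open>V\<close> and is an admissible coefficient of
        \<open>g k\<close>.\<close>
      have "y \<in> supp (u j + Poly_Mapping.single x 1)" unfolding xy[symmetric] by (simp add: supp_add_nat)
      moreover have "x \<in> V" using x YV unfolding X by blast
      ultimately have "y \<in> V" using V[OF j] by (auto simp: supp_add_nat split: if_splits)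
      define w :: "nat \<Rightarrow> ('v, 'k) mpoly" where "w i = (if i = k then var y else 0)" for i
      have "w \<in> graded_vectors V j {1}"
        using k \<open>y \<in> V\<close> by (auto simp: graded_vectors_def w_def intro: graded_part_var)
      moreover have "var x * g j r = (\<Sum>i<j. w i * g i r)" for r
      proof -
        have "(\<Sum>i<j. w i * g i r) = (\<Sum>i<j. if i = k then var y * g i r else 0)"
          by (intro sum.cong) (auto simp: w_def)
        also have "\<dots> = var y * g k r" using k by simp
        also have "\<dots> = var x * g j r"
          using xy by (simp add: g_def var_def mult_single add.commute)
        finally show ?thesis by simp
      qed
      ultimately show ?thesis by blast
    qed
  qed
  then show ?thesis unfolding g_def by blast
qed

lemma lincomb_monomials_image:
  assumes "\<And>j. j < L \<Longrightarrow> supp (u j) \<subseteq> V"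
  shows "(\<lambda>v. lincomb L (\<lambda>j r. if r = 0 then monomial (u j) else 0) v 0) ` graded_vectors V L UNIV =
    (monomial_ideal V (u ` {..<L}) :: ('v, 'k::field) mpoly set)"
proof (intro equalityI subsetI)
  fix p :: "('v, 'k) mpoly"
  assume "p \<in> (\<lambda>v. lincomb L (\<lambda>j r. if r = 0 then monomial (u j) else 0) v 0) ` graded_vectors V L UNIV"
  then obtain v where v: "v \<in> graded_vectors V L UNIV" and p: "p = (\<Sum>j<L. v j * monomial (u j))"
    by (auto simp: lincomb_def)
  have "v j * monomial (u j) \<in> graded_part V UNIV" if "j < L" for j
    by (rule graded_part_times[OF graded_vectors_comp[OF v] graded_part_monomial[of _ _ UNIV]])
      (use assms that in auto)
  then have "p \<in> carrier (poly_ring V)"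
    unfolding p graded_part_UNIV[symmetric] by (intro graded_part_sum) auto
  moreover have "\<exists>w\<in>u ` {..<L}. \<exists>s. t = s + w" if t: "t \<in> supp p" for t
  proof -
    obtain j where j: "j < L" "t \<in> supp (v j * monomial (u j))"
      using t supp_sum_subset[of "\<lambda>j. v j * monomial (u j)" "{..<L}"] unfolding p by auto
    then obtain s where "t = s + u j" by (auto elim: in_supp_times_monomialE)
    with j(1) show ?thesis by blast
  qed
  ultimately show "p \<in> monomial_ideal V (u ` {..<L})" by (simp add: monomial_ideal_def)
next
  fix p :: "('v, 'k) mpoly"
  assume p: "p \<in> monomial_ideal V (u ` {..<L})"
  then have "\<exists>i<L. \<exists>s. t = s + u i" if "t \<in> supp p" for t
    using that by (fastforce simp: monomial_ideal_def)
  from monomial_division[OF this] obtain q where q: "p = (\<Sum>i<L. q i * monomial (u i))"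
    "\<And>i s. i < L \<Longrightarrow> s \<in> supp (q i) \<Longrightarrow> s + u i \<in> supp p" by blast
  have "supp s \<subseteq> V" if "i < L" "s \<in> supp (q i)" for i s
  proof -
    have "supp (s + u i) \<subseteq> V" using q(2)[OF that] p by (auto simp: monomial_ideal_def poly_ring_simps(1))
    then show ?thesis by (simp add: supp_add_nat)
  qed
  \<comment> \<open>Nothing is known about \<open>q\<close> from index \<open>L\<close> on, so it is
    cut off there to give a vector of rank \<open>L\<close>.\<close>
  then have "(\<lambda>i. if i < L then q i else 0) \<in> graded_vectors V L UNIV"
    by (auto simp: graded_vectors_def graded_part_def)
  then show "p \<in> (\<lambda>v. lincomb L (\<lambda>j r. if r = 0 then monomial (u j) else 0) v 0) ` graded_vectors V L UNIV"
    by (rule rev_image_eqI) (simp add: lincomb_def q(1))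
qed

lemma monomial_ideal_ideal:
  "ideal (monomial_ideal V T :: ('v, 'k::field) mpoly set) (poly_ring V)"
proof -
  interpret cring "poly_ring V :: ('v, 'k) mpoly ring" by (rule poly_ring_cring)
  show ?thesis
  proof (rule idealI)
    show "ring (poly_ring V :: ('v, 'k) mpoly ring)" by (rule ring_axioms)
    show "subgroup (monomial_ideal V T :: ('v, 'k) mpoly set) (add_monoid (poly_ring V))"
    proof (rule add.subgroupI)
      show "\<ominus>\<^bsub>poly_ring V\<^esub> p \<in> monomial_ideal V T" if "p \<in> monomial_ideal V T" for p :: "('v, 'k) mpoly"
      proof -
        have "\<ominus>\<^bsub>poly_ring V\<^esub> p = - p"
          using that by (intro minus_equality) (auto simp: monomial_ideal_def poly_ring_simps(2-) poly_ring_closed)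
        then show ?thesis using that by (simp add: monomial_ideal_def poly_ring_closed)
      qed
      show "p \<oplus>\<^bsub>poly_ring V\<^esub> q \<in> monomial_ideal V T"
        if "p \<in> monomial_ideal V T" "q \<in> monomial_ideal V T" for p q :: "('v, 'k) mpoly"
        using that Poly_Mapping.keys_add[of p q]
        by (auto simp: monomial_ideal_def poly_ring_simps(2-) poly_ring_closed)
      have "0 \<in> monomial_ideal V T" by (simp add: monomial_ideal_def poly_ring_closed)
      then show "monomial_ideal V T \<noteq> {}" by blast
    qed (auto simp: monomial_ideal_def)
    have "p * q \<in> monomial_ideal V T"
      if p: "p \<in> monomial_ideal V T" and q: "q \<in> carrier (poly_ring V)" for p q :: "('v, 'k) mpoly"
      unfolding monomial_ideal_def
    proof (intro CollectI conjI ballI)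
      show "p * q \<in> carrier (poly_ring V)" using p q by (simp add: monomial_ideal_def poly_ring_closed)
      fix t assume "t \<in> supp (p * q)"
      then obtain a b where t: "t = a + b" "a \<in> supp p" by (rule in_supp_timesE)
      then obtain u s where "u \<in> T" "a = s + u" using p by (auto simp: monomial_ideal_def)
      then show "\<exists>u\<in>T. \<exists>s. t = s + u" using t by (metis add.assoc add.commute)
    qed
    then show "p \<otimes>\<^bsub>poly_ring V\<^esub> q \<in> monomial_ideal V T" "q \<otimes>\<^bsub>poly_ring V\<^esub> p \<in> monomial_ideal V T"
      if "p \<in> monomial_ideal V T" "q \<in> carrier (poly_ring V)" for p q :: "('v, 'k) mpoly"
      using that by (simp_all add: poly_ring_simps(2) mult.commute)
  qed
qed

lemma monomial_ideal_subset:
  fixes I :: "('v, 'k::field) mpoly set"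
  assumes I: "ideal I (poly_ring V)" and T: "\<And>u. u \<in> T \<Longrightarrow> monomial u \<in> I"
  shows "monomial_ideal V T \<subseteq> I"
proof
  fix p :: "('v, 'k) mpoly" assume p: "p \<in> monomial_ideal V T"
  show "p \<in> I"
  proof (subst sum_monomials, rule ideal_sum_closed[OF I])
    fix t assume t: "t \<in> supp p"
    then obtain u s where us: "u \<in> T" "t = s + u" "supp t \<subseteq> V"
      using p by (auto simp: monomial_ideal_def poly_ring_simps(1))
    define c where "c = Poly_Mapping.lookup p t"
    have "Poly_Mapping.single s c \<in> carrier (poly_ring V)"
      using us by (simp add: poly_ring_simps(1) supp_add_nat)
    from ideal.I_l_closed[OF I T[OF us(1)] this]
    show "Poly_Mapping.single t c \<in> I"
      by (simp add: poly_ring_simps(2) mult_single us(2))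
  qed
qed

lemma monomial_in_monomial_ideal:
  "u \<in> T \<Longrightarrow> supp u \<subseteq> V \<Longrightarrow> monomial u \<in> monomial_ideal V T"
  by (auto simp: monomial_ideal_def poly_ring_simps(1) intro!: bexI[of _ u] exI[of _ 0])

lemma Idl_monomials:
  fixes T :: "('v \<Rightarrow>\<^sub>0 nat) set"
  assumes "\<And>u. u \<in> T \<Longrightarrow> supp u \<subseteq> V"
  shows "Idl\<^bsub>poly_ring V\<^esub> (monomial ` T) = (monomial_ideal V T :: ('v, 'k::field) mpoly set)"
proof -
  interpret cring "poly_ring V :: ('v, 'k) mpoly ring" by (rule poly_ring_cring)
  have sub: "monomial ` T \<subseteq> (monomial_ideal V T :: ('v, 'k) mpoly set)"
    using assms by (auto intro: monomial_in_monomial_ideal)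
  then have carr: "monomial ` T \<subseteq> carrier (poly_ring V :: ('v, 'k) mpoly ring)"
    by (auto simp: monomial_ideal_def)
  show ?thesis
  proof (rule equalityI)
    show "Idl\<^bsub>poly_ring V\<^esub> (monomial ` T) \<subseteq> (monomial_ideal V T :: ('v, 'k) mpoly set)"
      by (rule genideal_minimal[OF monomial_ideal_ideal sub])
    show "(monomial_ideal V T :: ('v, 'k) mpoly set) \<subseteq> Idl\<^bsub>poly_ring V\<^esub> (monomial ` T)"
      using genideal_self[OF carr] by (intro monomial_ideal_subset genideal_ideal[OF carr]) blast
  qed
qed

section \<open>Products of monomial ideals\<close>

lemma monomial_ideal_prod:
  fixes A B :: "('v \<Rightarrow>\<^sub>0 nat) set"
  assumes "\<And>u. u \<in> A \<Longrightarrow> supp u \<subseteq> V" "\<And>u. u \<in> B \<Longrightarrow> supp u \<subseteq> V"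
  shows "ideal_prod (poly_ring V) (monomial_ideal V A) (monomial_ideal V B) =
    (monomial_ideal V {a + b |a b. a \<in> A \<and> b \<in> B} :: ('v, 'k::field) mpoly set)"
    (is "?L = ?R")
proof (rule equalityI)
  interpret cring "poly_ring V :: ('v, 'k) mpoly ring" by (rule poly_ring_cring)
  show "?R \<subseteq> ?L"
  proof (rule monomial_ideal_subset[OF ideal_prod_is_ideal[OF monomial_ideal_ideal monomial_ideal_ideal]])
    fix u assume "u \<in> {a + b |a b. a \<in> A \<and> b \<in> B}"
    then obtain a b where ab: "u = a + b" "a \<in> A" "b \<in> B" by blast
    have "monomial a \<otimes>\<^bsub>poly_ring V\<^esub> monomial b \<in> ?L"
      using ab assms by (intro ideal_prod.prod monomial_in_monomial_ideal) auto
    then show "monomial u \<in> ?L" by (simp add: poly_ring_simps(2) mult_single ab(1))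
  qed
  interpret R: ideal ?R "poly_ring V" by (rule monomial_ideal_ideal)
  show "?L \<subseteq> ?R"
  proof
    fix p assume "p \<in> ?L"
    then show "p \<in> ?R"
    proof induction
      case (prod p q)
      have "\<exists>u\<in>{a + b |a b. a \<in> A \<and> b \<in> B}. \<exists>s. t = s + u" if pq: "t \<in> supp (p * q)" for t
      proof -
        obtain x y where t: "t = x + y" "x \<in> supp p" "y \<in> supp q" using pq by (rule in_supp_timesE)
        then obtain a s b r where "a \<in> A" "x = s + a" "b \<in> B" "y = r + b"
          using prod unfolding monomial_ideal_def by blast
        then have "t = (s + r) + (a + b)" "a + b \<in> {a + b |a b. a \<in> A \<and> b \<in> B}"
          unfolding t(1) by (auto simp: ac_simps)
        then show ?thesis by blast
      qed
      moreover have "p * q \<in> carrier (poly_ring V)"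
        using prod unfolding monomial_ideal_def by (blast intro: poly_ring_closed)
      ultimately show ?case
        unfolding poly_ring_simps(2) by (subst monomial_ideal_def) (intro CollectI conjI ballI)
    next
      case (sum p q)
      then show ?case by simp
    qed
  qed
qed

text \<open>Makes the rules for \<open>finprod\<close> available for products of ideals, so that
  they can be computed by induction on the number of factors.\<close>

lemma (in cring) comm_monoid_ideals_set: "Group.comm_monoid (ideals_set R)"
proof (rule comm_monoidI)
  fix I J K assume "I \<in> carrier (ideals_set R)" "J \<in> carrier (ideals_set R)" "K \<in> carrier (ideals_set R)"
  then show "I \<otimes>\<^bsub>ideals_set R\<^esub> J \<otimes>\<^bsub>ideals_set R\<^esub> K = I \<otimes>\<^bsub>ideals_set R\<^esub> (J \<otimes>\<^bsub>ideals_set R\<^esub> K)"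
    by (simp add: ideals_set_def ideal_prod_assoc)
next
  fix I assume "I \<in> carrier (ideals_set R)"
  then show "\<one>\<^bsub>ideals_set R\<^esub> \<otimes>\<^bsub>ideals_set R\<^esub> I = I"
    by (simp add: ideals_set_def ideal_prod_commute[OF oneideal] ideal_prod_one)
qed (auto simp: ideals_set_def ideal_prod_is_ideal ideal_prod_commute oneideal)

lemma monomial_ideal_finprod:
  fixes T :: "'i \<Rightarrow> ('v \<Rightarrow>\<^sub>0 nat) set"
  assumes "finite A" "\<And>i u. i \<in> A \<Longrightarrow> u \<in> T i \<Longrightarrow> supp u \<subseteq> V"
  shows "(\<Otimes>\<^bsub>ideals_set (poly_ring V)\<^esub> i\<in>A. monomial_ideal V (T i)) =
    (monomial_ideal V {\<Sum>i\<in>A. t i |t. \<forall>i\<in>A. t i \<in> T i} :: ('v, 'k::field) mpoly set)"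
proof -
  interpret cring "poly_ring V :: ('v, 'k) mpoly ring" by (rule poly_ring_cring)
  interpret M: Group.comm_monoid "ideals_set (poly_ring V :: ('v, 'k) mpoly ring)"
    by (rule comm_monoid_ideals_set)
  have carr: "(\<lambda>i. monomial_ideal V (T i)) \<in> B \<rightarrow> carrier (ideals_set (poly_ring V :: ('v, 'k) mpoly ring))" for B
    by (simp add: ideals_set_def monomial_ideal_ideal)
  show ?thesis using assms
  proof (induction A)
    case empty
    \<comment> \<open>The exponent vector 0 divides every term; the whole ring is also the empty
      product of ideals.\<close>
    have "(monomial_ideal V {0} :: ('v, 'k) mpoly set) = carrier (poly_ring V)"
      by (auto simp: monomial_ideal_def)
    then show ?case by (simp only: M.finprod_empty) (simp add: ideals_set_def)
  next
    case (insert j A)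
    have PQ: "{a + b |a b. a \<in> T j \<and> b \<in> {\<Sum>i\<in>A. t i |t. \<forall>i\<in>A. t i \<in> T i}} =
        {\<Sum>i\<in>insert j A. t i |t. \<forall>i\<in>insert j A. t i \<in> T i}" (is "?P = ?Q")
    proof (intro equalityI subsetI)
      fix x assume "x \<in> ?P"
      then obtain a t where "a \<in> T j" "\<forall>i\<in>A. t i \<in> T i" "x = a + (\<Sum>i\<in>A. t i)" by blast
      moreover have "(\<Sum>i\<in>A. (t(j := a)) i) = (\<Sum>i\<in>A. t i)"
        using insert.hyps by (intro sum.cong) auto
      ultimately have "x = (\<Sum>i\<in>insert j A. (t(j := a)) i)" "\<forall>i\<in>insert j A. (t(j := a)) i \<in> T i"
        using insert.hyps by auto
      then show "x \<in> ?Q" by (intro CollectI exI[of _ "t(j := a)"] conjI)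
    next
      fix x assume "x \<in> ?Q"
      then obtain t where "x = (\<Sum>i\<in>insert j A. t i)" "\<forall>i\<in>insert j A. t i \<in> T i" by blast
      then have "x = t j + (\<Sum>i\<in>A. t i)" "t j \<in> T j" "\<forall>i\<in>A. t i \<in> T i"
        using insert.hyps by simp_all
      then show "x \<in> ?P" by blast
    qed
    have sV: "supp u \<subseteq> V" if u: "u \<in> {\<Sum>i\<in>A. t i |t. \<forall>i\<in>A. t i \<in> T i}" for u
    proof -
      obtain t where t: "u = (\<Sum>i\<in>A. t i)" "\<forall>i\<in>A. t i \<in> T i" using u by blast
      show ?thesis unfolding t(1) using supp_sum_subset[of t A] t(2) insert.prems by blast
    qed
    have "ideal_prod (poly_ring V) (monomial_ideal V (T j))
        (monomial_ideal V {\<Sum>i\<in>A. t i |t. \<forall>i\<in>A. t i \<in> T i}) = (monomial_ideal V ?Q :: ('v, 'k) mpoly set)"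
      unfolding PQ[symmetric] using insert.prems sV by (intro monomial_ideal_prod) blast+
    moreover have IH: "(\<Otimes>\<^bsub>ideals_set (poly_ring V)\<^esub> i\<in>A. monomial_ideal V (T i)) =
        (monomial_ideal V {\<Sum>i\<in>A. t i |t. \<forall>i\<in>A. t i \<in> T i} :: ('v, 'k) mpoly set)"
      by (intro insert.IH insert.prems) auto
    have "(\<Otimes>\<^bsub>ideals_set (poly_ring V)\<^esub> i\<in>insert j A. monomial_ideal V (T i)) =
        (monomial_ideal V (T j) :: ('v, 'k) mpoly set) \<otimes>\<^bsub>ideals_set (poly_ring V)\<^esub>
          (\<Otimes>\<^bsub>ideals_set (poly_ring V)\<^esub> i\<in>A. monomial_ideal V (T i))"
      by (rule M.finprod_insert[OF insert.hyps carr]) (simp add: ideals_set_def monomial_ideal_ideal)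
    moreover have "I \<otimes>\<^bsub>ideals_set R\<^esub> J = ideal_prod R I J" for I J and R :: "('v, 'k) mpoly ring"
      by (simp add: ideals_set_def)
    ultimately show ?case unfolding IH by (simp only:)
  qed
qed

subsection \<open>Tableaux\<close>

lemma list_all2_insort:
  fixes x y :: "'a::linorder"
  assumes "list_all2 (\<le>) xs ys" "sorted xs" "sorted ys" "x \<le> y"
  shows "list_all2 (\<le>) (insort x xs) (insort y ys)"
  using assms
proof (induction arbitrary: x y rule: list_all2_induct)
  case (Cons a as b bs)
  have ih: "list_all2 (\<le>) (insort x as) (insort y bs)" if "x \<le> y" for x y
    using Cons.IH[of x y] Cons.prems that by simp
  \<comment> \<open>If only one of \<open>x\<close> and \<open>y\<close> goes to the front, the tail
    on that side is the old list. Rewriting this list as an insertion of its head lets the induction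
    hypothesis compare the tails.\<close>
  have "insort a as = a # as" "insort b bs = b # bs"
    using Cons.prems by (auto intro: insort_is_Cons)
  then show ?case
    using ih[of a y] ih[of x b] ih[of x y] Cons.hyps Cons.prems by auto
qed simp

lemma list_all2_sort:
  "list_all2 (\<le>) xs ys \<Longrightarrow> list_all2 (\<le>) (sort xs) (sort ys)" for xs ys :: "'a::linorder list"
  by (induction rule: list_all2_induct) (auto intro: list_all2_insort)

lemma sort_nth_le:
  fixes f g :: "nat \<Rightarrow> 'a::linorder"
  assumes "\<And>j. j < s \<Longrightarrow> f j \<le> g j" "j < s"
  shows "sort (map f [0..<s]) ! j \<le> sort (map g [0..<s]) ! j"
proof -
  have "list_all2 (\<le>) (map f [0..<s]) (map g [0..<s])"
    using assms(1) by (simp add: list_all2_conv_all_nth)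
  from list_all2_sort[OF this] show ?thesis using assms(2) by (simp add: list_all2_conv_all_nth)
qed

text \<open>Strict comparison is weak comparison after applying \<open>Suc\<close> to the smaller
  side, and \<open>Suc\<close>, being monotone, commutes with sorting.\<close>

lemma sort_nth_less:
  fixes f g :: "nat \<Rightarrow> nat"
  assumes "\<And>j. j < s \<Longrightarrow> f j < g j" "j < s"
  shows "sort (map f [0..<s]) ! j < sort (map g [0..<s]) ! j"
proof -
  have "sort (map (\<lambda>j. Suc (f j)) [0..<s]) = map Suc (sort (map f [0..<s]))"
    by (rule properties_for_sort) (simp_all add: sorted_map multiset.map_comp comp_def)
  with sort_nth_le[of s "\<lambda>j. Suc (f j)" g j] assms show ?thesis by (simp add: Suc_le_eq)
qed

text \<open>Sorting keeps the multiset of entries. This is why sorting a row does not change its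
  monomial.\<close>

lemma sum_nth_sort:
  fixes f :: "'a::linorder \<Rightarrow> 'b::comm_monoid_add"
  shows "(\<Sum>j<length xs. f (sort xs ! j)) = (\<Sum>j<length xs. f (xs ! j))"
proof -
  have *: "(\<Sum>j<length ys. f (ys ! j)) = sum_mset (image_mset f (mset ys))" for ys
    unfolding mset_map[symmetric] sum_mset_sum_list by (simp add: sum_list_sum_nth atLeast0LessThan)
  show ?thesis using *[of "sort xs"] *[of xs] by simp
qed

text \<open>Used on two levels: for tableaux as lists of rows and for rows as lists of
  entries.\<close>

lemma list_less_iff_take_index:
  "length xs = length ys \<Longrightarrow>
    xs < ys \<longleftrightarrow> (\<exists>i<length xs. take i xs = take i ys \<and> xs ! i < ys ! i)"
  by (auto simp: list_less_def lexord_take_index_conv)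

text \<open>Lists of rows are used so that the order on \<open>nat list list\<close> compares
  entries lexicographically, row by row. Positions count from 0 but the bounds are indexed from 1,
  hence \<open>Suc j\<close>.\<close>

definition tableaux :: "nat \<Rightarrow> nat \<Rightarrow> (nat \<Rightarrow> nat) \<Rightarrow> (nat \<Rightarrow> nat) \<Rightarrow> nat list list set" where
  "tableaux m s k l = {T. length T = m \<and>
     (\<forall>i<m. length (T ! i) = s \<and> sorted (T ! i) \<and> (\<forall>j<s. k (Suc j) \<le> T ! i ! j \<and> T ! i ! j \<le> l (Suc j))) \<and>
     (\<forall>i i' j. i < i' \<longrightarrow> i' < m \<longrightarrow> j < s \<longrightarrow> T ! i ! j < T ! i' ! j)}"

definition tableau_monomial :: "nat \<Rightarrow> nat \<Rightarrow> nat list list \<Rightarrow> nat \<times> nat \<Rightarrow>\<^sub>0 nat" where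
  "tableau_monomial m s T =
     (\<Sum>p\<in>{..<m} \<times> {..<s}. Poly_Mapping.single (Suc (fst p), T ! fst p ! snd p) 1)"

lemma finite_tableaux: "finite (tableaux m s k l)"
proof (rule finite_subset)
  let ?R = "{R. set R \<subseteq> (\<Union>j<s. {..l (Suc j)}) \<and> length R = s}"
  show "tableaux m s k l \<subseteq> {T. set T \<subseteq> ?R \<and> length T = m}"
    by (fastforce simp: tableaux_def in_set_conv_nth)
  have "finite ?R" by (intro finite_lists_length_eq) auto
  then show "finite {T. set T \<subseteq> ?R \<and> length T = m}" by (rule finite_lists_length_eq)
qed

lemma monom_degree_tableau: "monom_degree (tableau_monomial m s T) = s * m"
  by (simp add: tableau_monomial_def monom_degree_sum)

lemma lookup_tableau_monomial:
  "Poly_Mapping.lookup (tableau_monomial m s T) (Suc i, x) =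
    card {p \<in> {..<m} \<times> {..<s}. fst p = i \<and> T ! fst p ! snd p = x}"
  unfolding tableau_monomial_def lookup_sum lookup_single when_def
  by (simp add: sum.If_cases Int_def)

text \<open>At the first difference the entry of \<open>A\<close> replaces that of \<open>B\<close>.
  To the left and above, \<open>B\<close> agrees with \<open>A\<close>; to the right and below, its
  entries are at least the replaced one, which exceeds the new one. Thus rows and columns stay
  ordered, and the interval condition is inherited from \<open>A\<close>.\<close>

lemma tableaux_exchange:
  assumes A: "A \<in> tableaux m s k l" and B: "B \<in> tableaux m s k l" and less: "A < B"
  shows "\<exists>C\<in>tableaux m s k l. C < B \<and> (\<exists>x y.
    tableau_monomial m s C + Poly_Mapping.single y 1 = tableau_monomial m s B + Poly_Mapping.single x 1 \<and>
    Poly_Mapping.lookup (tableau_monomial m s B) x < Poly_Mapping.lookup (tableau_monomial m s A) x)"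
proof -
  have len: "length A = m" "length B = m" "\<And>i. i < m \<Longrightarrow> length (A ! i) = s" "\<And>i. i < m \<Longrightarrow> length (B ! i) = s"
    using A B by (auto simp: tableaux_def)
  obtain i where i: "i < m" "take i A = take i B" "A ! i < B ! i"
    using less list_less_iff_take_index[of A B] len by auto
  obtain j where j: "j < s" "take j (A ! i) = take j (B ! i)" "A ! i ! j < B ! i ! j"
    using i(3) list_less_iff_take_index[of "A ! i" "B ! i"] len i(1) by auto
  have rows: "A ! i' = B ! i'" if "i' < i" for i' using i(2) that by (metis nth_take)
  have entries: "A ! i ! j' = B ! i ! j'" if "j' < j" for j' using j(2) that by (metis nth_take)
  define x where "x = A ! i ! j"
  define C where "C = B[i := (B ! i)[j := x]]"
  have C_nth: "C ! i' ! j' = (if i' = i \<and> j' = j then x else B ! i' ! j')" if "i' < m" "j' < s" for i' j'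
    using that len i(1) j(1) by (auto simp: C_def nth_list_update)
  have sA: "A ! i ! j1 \<le> A ! i ! j2" and sB: "B ! i ! j1 \<le> B ! i ! j2" if "j1 \<le> j2" "j2 < s" for j1 j2
    using A B i(1) that by (auto simp: tableaux_def intro: sorted_nth_mono)
  have lenC: "length C = m" "\<And>i'. i' < m \<Longrightarrow> length (C ! i') = s"
    using len i(1) by (auto simp: C_def nth_list_update)
  have "C \<in> tableaux m s k l"
    unfolding tableaux_def
  proof (intro CollectI conjI allI impI)
    show "length C = m" by (rule lenC)
    fix i' assume i': "i' < m"
    show "length (C ! i') = s" using i' by (rule lenC)
    show "sorted (C ! i')"
    proof (cases "i' = i")
      case False
      then have "C ! i' = B ! i'" by (simp add: C_def)
      then show ?thesis using B i' by (simp add: tableaux_def)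
    next
      case True
      have "C ! i ! j1 \<le> C ! i ! j2" if j12: "j1 < j2" "j2 < s" for j1 j2
        using sA[of j1 j2] sB[of j1 j2] sB[of j j2] entries[of j1] j12 j i(1)
        by (auto simp: C_nth x_def)
      then show ?thesis using True i(1) lenC(2) by (auto simp: sorted_wrt_iff_nth_less)
    qed
    fix j' assume "j' < s"
    then show "k (Suc j') \<le> C ! i' ! j'" "C ! i' ! j' \<le> l (Suc j')"
      using A B i' by (auto simp: C_nth tableaux_def x_def)
  next
    fix i1 i2 j' assume h: "i1 < i2" "i2 < m" "j' < s"
    have sm: "A ! i1 ! j' < A ! i2 ! j'" "B ! i1 ! j' < B ! i2 ! j'"
      using A B h by (auto simp: tableaux_def)
    show "C ! i1 ! j' < C ! i2 ! j'"
      using sm rows[of i1] j(3) h by (auto simp: C_nth x_def)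
  qed
  moreover have "(B ! i)[j := x] < B ! i"
    using j i(1) len by (subst list_less_iff_take_index) (auto simp: x_def intro!: exI[of _ j])
  then have "C < B"
    using i(1) len by (subst list_less_iff_take_index) (auto simp: C_def intro!: exI[of _ i])
  moreover have "tableau_monomial m s C + Poly_Mapping.single (Suc i, B ! i ! j) 1 =
      tableau_monomial m s B + Poly_Mapping.single (Suc i, x) 1"
  proof -
    \<comment> \<open>\<open>B\<close> and \<open>C\<close> agree away from \<open>(i, j)\<close>,
      so their monomials differ only in the factor at that position.\<close>
    let ?P = "{..<m} \<times> {..<s} - {(i, j)}"
    have split: "tableau_monomial m s T = Poly_Mapping.single (Suc i, T ! i ! j) 1 +
        (\<Sum>p\<in>?P. Poly_Mapping.single (Suc (fst p), T ! fst p ! snd p) 1)" for T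
      unfolding tableau_monomial_def using i(1) j(1) by (subst sum.remove[of _ "(i, j)"]) auto
    have "(\<Sum>p\<in>?P. Poly_Mapping.single (Suc (fst p), C ! fst p ! snd p) 1) =
        (\<Sum>p\<in>?P. Poly_Mapping.single (Suc (fst p), B ! fst p ! snd p) (1::nat))"
    proof (rule sum.cong[OF refl])
      fix p assume "p \<in> ?P"
      then have "C ! fst p ! snd p = B ! fst p ! snd p" by (cases p) (auto simp: C_nth)
      then show "Poly_Mapping.single (Suc (fst p), C ! fst p ! snd p) 1 =
          Poly_Mapping.single (Suc (fst p), B ! fst p ! snd p) (1::nat)" by simp
    qed
    then show ?thesis using i(1) j(1) by (simp add: split[of B] split[of C] C_nth ac_simps)
  qed
  moreover have "Poly_Mapping.lookup (tableau_monomial m s B) (Suc i, x)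
      < Poly_Mapping.lookup (tableau_monomial m s A) (Suc i, x)"
    unfolding lookup_tableau_monomial
  proof (rule psubset_card_mono)
    \<comment> \<open>From position \<open>j\<close> on, row \<open>i\<close> of \<open>B\<close>
      exceeds \<open>x\<close>. Hence every \<open>x\<close> in that row lies in the prefix shared
      with \<open>A\<close>, while \<open>A\<close> has a further one at \<open>j\<close>.\<close>
    have "j' < j" if "j' < s" "B ! i ! j' = x" for j'
      using sB[of j j'] that j(3) by (force simp: x_def)
    then have "{p \<in> {..<m} \<times> {..<s}. fst p = i \<and> B ! fst p ! snd p = x} \<subseteq>
        {p \<in> {..<m} \<times> {..<s}. fst p = i \<and> A ! fst p ! snd p = x}"
      using entries by auto
    moreover have "(i, j) \<in> {p \<in> {..<m} \<times> {..<s}. fst p = i \<and> A ! fst p ! snd p = x}"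
      "(i, j) \<notin> {p \<in> {..<m} \<times> {..<s}. fst p = i \<and> B ! fst p ! snd p = x}"
      using i(1) j by (auto simp: x_def)
    ultimately show "{p \<in> {..<m} \<times> {..<s}. fst p = i \<and> B ! fst p ! snd p = x} \<subset>
        {p \<in> {..<m} \<times> {..<s}. fst p = i \<and> A ! fst p ! snd p = x}" by blast
  qed simp
  ultimately show ?thesis by blast
qed

section \<open>Products of diagonal monomials as tableau monomials\<close>

definition diagonals :: "nat \<Rightarrow> nat \<Rightarrow> nat \<Rightarrow> (nat \<times> nat \<Rightarrow>\<^sub>0 nat) set" where
  "diagonals m a b = {\<Sum>i\<in>{1..m}. Poly_Mapping.single (i, c i) 1 | c.
     c \<in> {1..m} \<rightarrow> {a..b} \<and> strict_mono_on {1..m} c}"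

lemma supp_diagonals:
  assumes "u \<in> diagonals m a b" "1 \<le> a" "b \<le> n"
  shows "supp u \<subseteq> {1..m} \<times> {1..n}"
proof -
  obtain c where c: "u = (\<Sum>i\<in>{1..m}. Poly_Mapping.single (i, c i) 1)" "c \<in> {1..m} \<rightarrow> {a..b}"
    using assms(1) by (auto simp: diagonals_def)
  have "supp u \<subseteq> (\<Union>i\<in>{1..m}. {(i, c i)})"
    unfolding c(1) using supp_sum_subset[of "\<lambda>i. Poly_Mapping.single (i, c i) (1::nat)" "{1..m}"] by simp
  also have "c i \<in> {1..n}" if "i \<in> {1..m}" for i
    using funcset_mem[OF c(2) that] assms(2,3) by simp
  then have "(\<Union>i\<in>{1..m}. {(i, c i)}) \<subseteq> {1..m} \<times> {1..n}" by blast
  finally show ?thesis .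
qed

lemma prod_var: "(\<Prod>i\<in>A. var (f i)) = monomial (\<Sum>i\<in>A. Poly_Mapping.single (f i) 1)"
  by (induction A rule: infinite_finite_induct) (auto simp: var_def mult_single)

lemma diagonal_ideal_eq:
  assumes "1 \<le> a" "b \<le> n"
  shows "diagonal_ideal m n a b = monomial_ideal ({1..m} \<times> {1..n}) (diagonals m a b)"
proof -
  have eq: "diagonal_monomials m a b = monomial ` diagonals m a b"
    unfolding diagonal_monomials_def diagonals_def prod_var by blast
  show ?thesis
    unfolding diagonal_ideal_def eq by (rule Idl_monomials[OF supp_diagonals[OF _ assms]])
qed

lemma tableau_monomial_sum:
  "tableau_monomial m s T = (\<Sum>i<m. \<Sum>j<s. Poly_Mapping.single (Suc i, T ! i ! j) 1)"
  by (simp add: tableau_monomial_def sum.cartesian_product split_beta)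

text \<open>Put the \<open>s\<close> diagonals side by side as columns of an array and sort each
  row. The monomial is unchanged, strict inequalities down the columns survive by
  \<open>sort_nth_less\<close>, and the bounds survive because \<open>k\<close> and \<open>l\<close>
  are monotone. Conversely, the columns of a tableau are diagonals.\<close>

lemma sums_of_diagonals:
  assumes k: "mono_on {1..s} k" and l: "mono_on {1..s} l"
  shows "{\<Sum>j\<in>{1..s}. t j |t. \<forall>j\<in>{1..s}. t j \<in> diagonals m (k j) (l j)} =
    tableau_monomial m s ` tableaux m s k l"
proof (intro equalityI subsetI)
  fix u assume "u \<in> {\<Sum>j\<in>{1..s}. t j |t. \<forall>j\<in>{1..s}. t j \<in> diagonals m (k j) (l j)}"
  then obtain t where u: "u = (\<Sum>j\<in>{1..s}. t j)" and "\<forall>j\<in>{1..s}. t j \<in> diagonals m (k j) (l j)" by blast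
  then have "\<forall>j\<in>{1..s}. \<exists>c. t j = (\<Sum>i\<in>{1..m}. Poly_Mapping.single (i, c i) 1) \<and>
      c \<in> {1..m} \<rightarrow> {k j..l j} \<and> strict_mono_on {1..m} c" by (auto simp: diagonals_def)
  from bchoice[OF this] obtain c where c: "\<And>j. j \<in> {1..s} \<Longrightarrow> t j = (\<Sum>i\<in>{1..m}. Poly_Mapping.single (i, c j i) 1)"
    "\<And>j. j \<in> {1..s} \<Longrightarrow> c j \<in> {1..m} \<rightarrow> {k j..l j}" "\<And>j. j \<in> {1..s} \<Longrightarrow> strict_mono_on {1..m} (c j)" by blast
  define row where "row i = map (\<lambda>j. c (Suc j) (Suc i)) [0..<s]" for i
  define T where "T = map (\<lambda>i. sort (row i)) [0..<m]"
  have T_nth: "T ! i = sort (row i)" if "i < m" for i using that by (simp add: T_def)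
  have "tableau_monomial m s T = (\<Sum>i<m. \<Sum>j<s. Poly_Mapping.single (Suc i, row i ! j) 1)"
    unfolding tableau_monomial_sum
  proof (rule sum.cong[OF refl])
    fix i assume "i \<in> {..<m}"
    then show "(\<Sum>j<s. Poly_Mapping.single (Suc i, T ! i ! j) (1::nat)) =
        (\<Sum>j<s. Poly_Mapping.single (Suc i, row i ! j) 1)"
      using sum_nth_sort[of "\<lambda>x. Poly_Mapping.single (Suc i, x) (1::nat)" "row i"] by (simp add: T_nth row_def)
  qed
  \<comment> \<open>Summing the unsorted array by columns recovers the given diagonals.\<close>
  also have "\<dots> = (\<Sum>j<s. \<Sum>i<m. Poly_Mapping.single (Suc i, c (Suc j) (Suc i)) 1)"
    by (subst sum.swap) (simp add: row_def)
  also have "\<dots> = u" by (simp add: u c(1) sum.atLeast1_atMost_eq)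
  finally have "u = tableau_monomial m s T" ..
  moreover have "T \<in> tableaux m s k l"
    unfolding tableaux_def
  proof (intro CollectI conjI allI impI)
    show "length T = m" by (simp add: T_def)
    fix i assume i: "i < m"
    show "length (T ! i) = s" "sorted (T ! i)" using i by (simp_all add: T_nth row_def)
    fix j assume j: "j < s"
    have bounds: "k (Suc j) \<le> c (Suc j) (Suc i)" "c (Suc j) (Suc i) \<le> l (Suc j)" if "j < s" for j
      using c(2)[of "Suc j"] that i by (auto simp: Pi_iff)
    \<comment> \<open>The bounds are already sorted, so comparing sorted rows with sorted bounds
      gives the bound for each column index.\<close>
    have id: "sort (map (\<lambda>j. f (Suc j)) [0..<s]) = map (\<lambda>j. f (Suc j)) [0..<s]"
      if "mono_on {1..s} f" for f :: "nat \<Rightarrow> nat"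
      using that by (intro sorted_sort_id) (auto simp: sorted_iff_nth_mono intro!: mono_onD[OF that])
    show "k (Suc j) \<le> T ! i ! j"
      using sort_nth_le[of s "\<lambda>j. k (Suc j)" "\<lambda>j. c (Suc j) (Suc i)" j] bounds j i
      by (simp add: id[OF k] T_nth row_def)
    show "T ! i ! j \<le> l (Suc j)"
      using sort_nth_le[of s "\<lambda>j. c (Suc j) (Suc i)" "\<lambda>j. l (Suc j)" j] bounds j i
      by (simp add: id[OF l] T_nth row_def)
  next
    fix i i' j assume h: "i < i'" "i' < m" "j < s"
    have "c (Suc j) (Suc i) < c (Suc j) (Suc i')" if "j < s" for j
      using c(3)[of "Suc j"] that h by (auto simp: strict_mono_on_def)
    then show "T ! i ! j < T ! i' ! j"
      using h by (simp add: T_nth row_def sort_nth_less)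
  qed
  ultimately show "u \<in> tableau_monomial m s ` tableaux m s k l" by blast
next
  fix u assume "u \<in> tableau_monomial m s ` tableaux m s k l"
  then obtain T where u: "u = tableau_monomial m s T" and T: "T \<in> tableaux m s k l" by blast
  \<comment> \<open>Column \<open>j\<close> of the tableau, with both indices moved from counting
    from 1 to counting from 0.\<close>
  define t where "t j = (\<Sum>i\<in>{1..m}. Poly_Mapping.single (i, T ! (i - 1) ! (j - 1)) (1::nat))" for j
  have "u = (\<Sum>j\<in>{1..s}. t j)"
    unfolding u tableau_monomial_sum t_def
    by (subst sum.swap) (simp add: sum.atLeast1_atMost_eq)
  moreover have "t j \<in> diagonals m (k j) (l j)" if j: "j \<in> {1..s}" for j
    unfolding diagonals_def t_def
  proof (intro CollectI exI[of _ "\<lambda>i. T ! (i - 1) ! (j - 1)"] conjI refl)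
    have "k j \<le> T ! (i - 1) ! (j - 1)" "T ! (i - 1) ! (j - 1) \<le> l j" if "i \<in> {1..m}" for i
    proof -
      have "i - 1 < m" "j - 1 < s" "Suc (j - 1) = j" using that j by auto
      then show "k j \<le> T ! (i - 1) ! (j - 1)" "T ! (i - 1) ! (j - 1) \<le> l j"
        using T unfolding tableaux_def by (metis (no_types, lifting) mem_Collect_eq)+
    qed
    then show "(\<lambda>i. T ! (i - 1) ! (j - 1)) \<in> {1..m} \<rightarrow> {k j..l j}" by auto
    show "strict_mono_on {1..m} (\<lambda>i. T ! (i - 1) ! (j - 1))"
      using T j by (auto simp: tableaux_def intro!: strict_mono_onI)
  qed
  ultimately show "u \<in> {\<Sum>j\<in>{1..s}. t j |t. \<forall>j\<in>{1..s}. t j \<in> diagonals m (k j) (l j)}" by blast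
qed

text \<open>Listing the finitely many tableaux in increasing lexicographic order turns
  \<open>tableaux_exchange\<close> into the exchange condition of
  \<open>monomial_linear_quotients\<close>.\<close>

lemma monomial_ideal_tableaux_linear_resolution:
  assumes "\<And>T. T \<in> tableaux m s k l \<Longrightarrow> supp (tableau_monomial m s T) \<subseteq> V"
  shows "has_linear_free_resolution V (s * m)
    (monomial_ideal V (tableau_monomial m s ` tableaux m s k l) :: (nat \<times> nat, 'k::field) mpoly set)"
proof -
  define Ts where "Ts = sorted_list_of_set (tableaux m s k l)"
  define L where "L = length Ts"
  define u where "u j = tableau_monomial m s (Ts ! j)" for j
  have set_Ts: "set Ts = tableaux m s k l" and sorted: "sorted_wrt (<) Ts"
    using finite_tableaux by (simp_all add: Ts_def)
  have T: "Ts ! j \<in> tableaux m s k l" if "j < L" for j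
    using that by (simp add: L_def flip: set_Ts)
  have V: "supp (u j) \<subseteq> V" if "j < L" for j using assms[OF T[OF that]] by (simp add: u_def)
  have "\<exists>X. linear_quotients V 1 (int (s * m)) L
      (\<lambda>j r. if r = 0 then monomial (u j) else 0 :: (nat \<times> nat, 'k) mpoly) X"
  proof (rule monomial_linear_quotients[OF V])
    show "monom_degree (u j) = s * m" for j by (simp add: u_def monom_degree_tableau)
    fix i j assume ij: "i < j" "j < L"
    then have "Ts ! i < Ts ! j" using sorted by (simp add: sorted_wrt_iff_nth_less L_def)
    then obtain C x y where C: "C \<in> tableaux m s k l" "C < Ts ! j"
      "tableau_monomial m s C + Poly_Mapping.single y 1 = u j + Poly_Mapping.single x 1"
      "Poly_Mapping.lookup (u j) x < Poly_Mapping.lookup (u i) x"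
      using tableaux_exchange[OF T T, of i j] ij unfolding u_def by auto
    then obtain p where p: "p < L" "C = Ts ! p" by (auto simp: L_def in_set_conv_nth simp flip: set_Ts)
    \<comment> \<open>The list is increasing, so the smaller tableau \<open>C\<close> stands at an
      earlier index.\<close>
    have "p < j"
    proof (rule ccontr)
      assume "\<not> p < j"
      then have "Ts ! j \<le> Ts ! p"
        using sorted p(1) by (cases "p = j") (auto simp: sorted_wrt_iff_nth_less L_def less_imp_le)
      then show False using C(2) p(2) by simp
    qed
    then show "\<exists>k<j. \<exists>x y. u k + Poly_Mapping.single y 1 = u j + Poly_Mapping.single x 1 \<and>
        Poly_Mapping.lookup (u j) x < Poly_Mapping.lookup (u i) x"
      using C(3,4) unfolding p(2) u_def[symmetric] by blast
  qed
  then obtain X where "linear_quotients V 1 (int (s * m)) L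
      (\<lambda>j r. if r = 0 then monomial (u j) else 0 :: (nat \<times> nat, 'k) mpoly) X" ..
  from linear_quotients_linear_resolution[OF this]
  have "has_linear_free_resolution V (s * m) (monomial_ideal V (u ` {..<L}) :: (nat \<times> nat, 'k) mpoly set)"
    by (subst (asm) lincomb_monomials_image) (use V in auto)
  moreover have "u ` {..<L} = tableau_monomial m s ` tableaux m s k l"
    unfolding set_Ts[symmetric] set_conv_nth by (auto simp: u_def L_def)
  ultimately show ?thesis by simp
qed

theorem theorem1p1:
  fixes m n s :: nat and k l :: "nat \<Rightarrow> nat"
  assumes "1 \<le> m" and "m \<le> n" and "1 \<le> s"
    and "mono_on {1..s} k" and "mono_on {1..s} l"
    and "\<And>i. i \<in> {1..s} \<Longrightarrow> 1 \<le> k i \<and> k i < n"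
    and "\<And>i. i \<in> {1..s} \<Longrightarrow> 1 < l i \<and> l i \<le> n"
    and "\<And>i. i \<in> {1..s} \<Longrightarrow> k i < l i \<and> m \<le> l i - k i + 1"
  shows "has_linear_free_resolution ({1..m} \<times> {1..n}) (s * m)
    ((\<Otimes>\<^bsub>ideals_set (matrix_ring m n)\<^esub> i\<in>{1..s}. diagonal_ideal m n (k i) (l i))
      :: (nat \<times> nat, 'k::field) mpoly set)"
proof -
  let ?V = "{1..m} \<times> {1..n}"
  let ?D = "\<lambda>i. diagonals m (k i) (l i)"
  interpret cring "matrix_ring m n :: (nat \<times> nat, 'k) mpoly ring" by (rule poly_ring_cring)
  interpret M: Group.comm_monoid "ideals_set (matrix_ring m n :: (nat \<times> nat, 'k) mpoly ring)"
    by (rule comm_monoid_ideals_set)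
  have supp: "supp u \<subseteq> ?V" if "i \<in> {1..s}" "u \<in> ?D i" for i u
    using supp_diagonals[OF that(2)] assms(6,7)[OF that(1)] by blast
  have "(\<Otimes>\<^bsub>ideals_set (matrix_ring m n)\<^esub> i\<in>{1..s}. diagonal_ideal m n (k i) (l i)) =
      ((\<Otimes>\<^bsub>ideals_set (matrix_ring m n)\<^esub> i\<in>{1..s}. monomial_ideal ?V (?D i)) :: (nat \<times> nat, 'k) mpoly set)"
  proof (rule M.finprod_cong')
    show "diagonal_ideal m n (k i) (l i) = monomial_ideal ?V (?D i)" if "i \<in> {1..s}" for i
      using assms(6,7)[OF that] by (intro diagonal_ideal_eq) auto
  qed (simp_all add: ideals_set_def monomial_ideal_ideal)
  also have "\<dots> = monomial_ideal ?V {\<Sum>i\<in>{1..s}. t i |t. \<forall>i\<in>{1..s}. t i \<in> ?D i}"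
    using supp by (intro monomial_ideal_finprod) auto
  also have "\<dots> = monomial_ideal ?V (tableau_monomial m s ` tableaux m s k l)"
    unfolding sums_of_diagonals[OF assms(4,5)] ..
  finally have J: "(\<Otimes>\<^bsub>ideals_set (matrix_ring m n)\<^esub> i\<in>{1..s}. diagonal_ideal m n (k i) (l i)) =
      (monomial_ideal ?V (tableau_monomial m s ` tableaux m s k l) :: (nat \<times> nat, 'k) mpoly set)" .
  show ?thesis
    unfolding J
  proof (rule monomial_ideal_tableaux_linear_resolution)
    fix T assume "T \<in> tableaux m s k l"
    \<comment> \<open>The same equality read backwards: as a sum of diagonals, the tableau monomial
      involves only variables of the matrix.\<close>
    then have "tableau_monomial m s T \<in> {\<Sum>i\<in>{1..s}. t i |t. \<forall>i\<in>{1..s}. t i \<in> ?D i}"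
      unfolding sums_of_diagonals[OF assms(4,5)] by blast
    then obtain t where t: "tableau_monomial m s T = (\<Sum>i\<in>{1..s}. t i)" "\<forall>i\<in>{1..s}. t i \<in> ?D i" by blast
    have "(\<Union>i\<in>{1..s}. supp (t i)) \<subseteq> ?V" using supp t(2) by (intro UN_least) blast
    then show "supp (tableau_monomial m s T) \<subseteq> ?V"
      unfolding t(1) by (rule order_trans[OF supp_sum_subset])
  qed
qed

end
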